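(* Let $(M,x)$ be a $d$-dimensional linear dynamical system with $M\in\mathbb{Q}^{d\times d}$ and $x\in\mathbb{Q}^d$ having only non-negative entries, with rounded orbit $(x^{(t)})_{t\in\mathbb{N}}$ under floating-point rounding, and let $Y\subseteq\mathbb{R}^d$ be a semialgebraic set. Then the hitting set $\mathcal{Z}(Y)=\{t\in\mathbb{N}\mid x^{(t)}\in Y\}$ is a semi-linear set.
   Context: A floating-point number with precision $p$ (base 10) is $\pm m\cdot10^\alpha$ with $\alpha\in\mathbb{Z}$ and $m\in\{0\}\cup[0.1,1)$ a decimal with $p$ digits after the decimal point. The floating-point rounding $[z]$ of a real $z$ is the closest floating-point number with precision $p$ determined by the first $p+1$ significant digits of $z$, ties broken by a fixed deterministic rule; it satisfies: there is $c>0$ with $|z|/c\le|[z]|\le c|z|$; $[10^\alpha z]=10^\alpha[z]$; $[z]$ depends only on the first $p+1$ digits of the mantissa of $z$; $\operatorname{sign}([z])=\operatorname{sign}(z)$. Rounding of vectors is componentwise; the rounded orbit is $x^{(0)}=[x]$, $x^{(t)}=[Mx^{(t-1)}]$. A semialgebraic set is defined by a finite Boolean combination of polynomial inequalities. A set $X\subseteq\mathbb{N}$ is semi-linear if there are a finite set $F\subseteq\mathbb{N}$ and integers $m,q,b_1,\dots,b_m\in\mathbb{N}$ such that $t\in X$ iff $t\in F$ or $t=b_i+kq$ for some $k\in\mathbb{N}$ and some $i\in\{1,\dots,m\}$ (a finite union of a finite set and linear sets $\{b+kq\mid k\in\mathbb{N}\}$). *)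

theory Defs
  imports "HOL-Analysis.Analysis"
begin

definition float_numbers :: "nat \<Rightarrow> real set" where
  "float_numbers p =
     {s * m * 10 powi \<alpha> | s m \<alpha>.
        s \<in> {-1, 1} \<and> (m = 0 \<or> 1/10 \<le> m \<and> m < 1) \<and> (\<exists>n::nat. m = real n / 10 ^ p)}"

(* The exponent \<alpha> with \<bar>z\<bar> = m * 10 powi \<alpha> and m in [0.1,1), for z \<noteq> 0. *)
definition dec_exponent :: "real \<Rightarrow> int" where
  "dec_exponent z = \<lfloor>log 10 \<bar>z\<bar>\<rfloor> + 1"

(* z with all but the first k significant decimal digits of its mantissa dropped. *)
definition first_digits :: "nat \<Rightarrow> real \<Rightarrow> real" where
  "first_digits k z =
     sgn z * real_of_int \<lfloor>\<bar>z\<bar> * 10 powi (int k - dec_exponent z)\<rfloor> * 10 powi (dec_exponent z - int k)"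

(* The rounding of z is a floating-point number of precision p that is closest to what the first
   p + 1 significant digits of z show.  Whenever two floating-point numbers are equally close, the
   choice is left open (this is the tie-breaking rule), except that it has to be determined by
   those digits and independent of the exponent.  In particular, every such function
   that always returns a floating-point number closest to z itself is covered. *)
definition float_rounding :: "nat \<Rightarrow> (real \<Rightarrow> real) \<Rightarrow> bool" where
  "float_rounding p r \<longleftrightarrow>
     (\<forall>z. is_arg_min (\<lambda>w. \<bar>w - first_digits (p + 1) z\<bar>) (\<lambda>w. w \<in> float_numbers p) (r z)) \<and>
     (\<forall>z z'. first_digits (p + 1) z = first_digits (p + 1) z' \<longrightarrow> r z = r z') \<and>
     (\<forall>z \<alpha>. r (10 powi \<alpha> * z) = 10 powi \<alpha> * r z)"

definition round_vec :: "(real \<Rightarrow> real) \<Rightarrow> real ^ 'n \<Rightarrow> real ^ 'n" where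
  "round_vec r v = (\<chi> i. r (v $ i))"

primrec rounded_orbit :: "(real \<Rightarrow> real) \<Rightarrow> real ^ 'n ^ 'n \<Rightarrow> real ^ 'n \<Rightarrow> nat \<Rightarrow> real ^ 'n" where
  "rounded_orbit r M x 0 = round_vec r x"
| "rounded_orbit r M x (Suc t) = round_vec r (M *v rounded_orbit r M x t)"

inductive semialgebraic :: "(real ^ 'n) set \<Rightarrow> bool" where
  ineq: "real_polynomial_function f \<Longrightarrow> semialgebraic {x. 0 \<le> f x}"
| compl: "semialgebraic A \<Longrightarrow> semialgebraic (- A)"
| inter: "semialgebraic A \<Longrightarrow> semialgebraic B \<Longrightarrow> semialgebraic (A \<inter> B)"
| union: "semialgebraic A \<Longrightarrow> semialgebraic B \<Longrightarrow> semialgebraic (A \<union> B)"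

definition semi_linear :: "nat set \<Rightarrow> bool" where
  "semi_linear X \<longleftrightarrow>
     (\<exists>(F :: nat set) (m :: nat) (q :: nat) (b :: nat \<Rightarrow> nat). finite F \<and>
        (\<forall>t. t \<in> X \<longleftrightarrow> t \<in> F \<or> (\<exists>k. \<exists>i\<in>{1..m}. t = b i + k * q)))"

definition hitting_set :: "(nat \<Rightarrow> 'a) \<Rightarrow> 'a set \<Rightarrow> nat set" where
  "hitting_set u Y = {t. u t \<in> Y}"

lemma dec_exponent_bounds:
  assumes "z \<noteq> 0"
  shows "10 powi (dec_exponent z - 1) \<le> \<bar>z\<bar>" and "\<bar>z\<bar> < 10 powi dec_exponent z"
proof -
  have z: "\<bar>z\<bar> = 10 powr (log 10 \<bar>z\<bar>)"
    using assms by simp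
  have "10 powr real_of_int (dec_exponent z - 1) \<le> 10 powr (log 10 \<bar>z\<bar>)"
    unfolding dec_exponent_def by (intro powr_mono) auto
  then show "10 powi (dec_exponent z - 1) \<le> \<bar>z\<bar>"
    using z by (subst (asm) powr_real_of_int') auto
  have "10 powr (log 10 \<bar>z\<bar>) < 10 powr real_of_int (dec_exponent z)"
    unfolding dec_exponent_def by (intro powr_less_mono) linarith+
  then show "\<bar>z\<bar> < 10 powi dec_exponent z"
    using z by (subst (asm) powr_real_of_int') auto
qed

lemma first_digits_0 [simp]: "first_digits k 0 = 0"
  by (simp add: first_digits_def)

lemma sgn_first_digits_bounds:
  assumes "z \<noteq> 0"
  shows "10 powi (dec_exponent z - 1) \<le> sgn z * first_digits (p + 1) z"
    and "sgn z * first_digits (p + 1) z \<le> \<bar>z\<bar>"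
proof -
  let ?e = "dec_exponent z"
  let ?u = "(10::real) powi (int (p + 1) - ?e)"
  let ?v = "(10::real) powi (?e - int (p + 1))"
  have eq: "sgn z * first_digits (p + 1) z = real_of_int \<lfloor>\<bar>z\<bar> * ?u\<rfloor> * ?v"
    using assms by (simp add: first_digits_def sgn_if)
  have uv: "?u * ?v = 1"
    by (subst power_int_add [symmetric]) auto
  have v: "?v > 0" by simp
  have "real_of_int \<lfloor>\<bar>z\<bar> * ?u\<rfloor> * ?v \<le> (\<bar>z\<bar> * ?u) * ?v"
    using v by (intro mult_right_mono) auto
  then show "sgn z * first_digits (p + 1) z \<le> \<bar>z\<bar>"
    using eq uv by (simp only: mult.assoc mult_1_right)
  have "10 powi (?e - 1) * ?u \<le> \<bar>z\<bar> * ?u"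
    using dec_exponent_bounds(1)[OF assms] by (intro mult_right_mono) auto
  moreover have "10 powi (?e - 1) * ?u = 10 ^ p"
    by (subst power_int_add [symmetric]) (auto simp: power_int_def)
  ultimately have "real_of_int (10 ^ p) \<le> \<bar>z\<bar> * ?u"
    by (simp only: of_int_power of_int_numeral)
  then have "(10::int) ^ p \<le> \<lfloor>\<bar>z\<bar> * ?u\<rfloor>"
    by (simp only: le_floor_iff)
  then have "(10::real) ^ p \<le> real_of_int \<lfloor>\<bar>z\<bar> * ?u\<rfloor>"
    by (metis of_int_le_iff of_int_numeral of_int_power)
  then have "10 ^ p * ?v \<le> real_of_int \<lfloor>\<bar>z\<bar> * ?u\<rfloor> * ?v"
    using v by (intro mult_right_mono) auto
  moreover have "10 ^ p * ?v = 10 powi (?e - 1)"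
    by (subst power_int_of_nat [symmetric], subst power_int_add [symmetric]) auto
  ultimately show "10 powi (?e - 1) \<le> sgn z * first_digits (p + 1) z"
    unfolding eq by (simp only:)
qed

lemma power_10_in_float_numbers:
  assumes "p \<ge> 1" and "s \<in> {-1, 1::real}"
  shows "s * 10 powi a \<in> float_numbers p"
proof -
  have "(1/10::real) = real (10 ^ (p - 1)) / 10 ^ p"
    using assms by (cases p) auto
  moreover have "s * 10 powi a = s * (1/10) * 10 powi (a + 1)"
    by (simp add: power_int_add)
  ultimately show ?thesis
    using assms(2) unfolding float_numbers_def mem_Collect_eq
    by (intro exI[of _ s] exI[of _ "1/10"] exI[of _ "a + 1"] conjI) (blast | simp)+
qed

lemma zero_in_float_numbers: "0 \<in> float_numbers p"
  unfolding float_numbers_def by force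

lemma float_rounding_closest:
  assumes "float_rounding p r" and "w \<in> float_numbers p"
  shows "\<bar>r z - first_digits (p + 1) z\<bar> \<le> \<bar>w - first_digits (p + 1) z\<bar>"
  using assms unfolding float_rounding_def is_arg_min_def by (meson linorder_not_le)

lemma float_rounding_0:
  assumes "float_rounding p r"
  shows "r 0 = 0"
  using float_rounding_closest[OF assms zero_in_float_numbers, of 0] by simp

lemma float_rounding_sgn_bounds:
  assumes "float_rounding p r" and "p \<ge> 1" and "z \<noteq> 0"
  shows "\<bar>z\<bar> / 10 \<le> sgn z * r z" and "sgn z * r z \<le> 2 * \<bar>z\<bar>"
proof -
  let ?T = "first_digits (p + 1) z" and ?w = "(10::real) powi (dec_exponent z - 1)"
  have s: "sgn z \<in> {-1, 1}" using assms(3) by (auto simp: sgn_if)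
  have "\<bar>r z - ?T\<bar> \<le> \<bar>sgn z * ?w - ?T\<bar>"
    using float_rounding_closest[OF assms(1) power_10_in_float_numbers[OF assms(2) s]] .
  then have le: "\<bar>sgn z * r z - sgn z * ?T\<bar> \<le> \<bar>?w - sgn z * ?T\<bar>"
    using s by auto
  have z: "\<bar>z\<bar> < 10 * ?w"
    using dec_exponent_bounds(2)[OF assms(3)] by (simp add: power_int_diff)
  have w: "?w > 0" by simp
  note b = sgn_first_digits_bounds[OF assms(3), of p]
  show "\<bar>z\<bar> / 10 \<le> sgn z * r z" "sgn z * r z \<le> 2 * \<bar>z\<bar>"
    using le z b w by linarith+
qed

lemma float_rounding_sgn:
  assumes "float_rounding p r" and "p \<ge> 1"
  shows "sgn (r z) = sgn z"
proof (cases "z = 0")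
  case False
  then have "sgn z * r z > 0"
    using float_rounding_sgn_bounds(1)[OF assms False] by (smt (verit) divide_pos_pos zero_less_abs_iff)
  then show ?thesis by (auto simp: sgn_if split: if_splits)
qed (use float_rounding_0[OF assms(1)] in simp)

lemma float_rounding_comparable:
  assumes "float_rounding p r" and "p \<ge> 1"
  shows "\<exists>c>0. \<forall>z. \<bar>z\<bar> / c \<le> \<bar>r z\<bar> \<and> \<bar>r z\<bar> \<le> c * \<bar>z\<bar>"
proof (intro exI[of _ 10] conjI allI)
  fix z :: real
  have eq: "\<bar>r z\<bar> = sgn z * r z"
    using float_rounding_sgn[OF assms, of z] by (metis abs_sgn mult.commute)
  show "\<bar>z\<bar> / 10 \<le> \<bar>r z\<bar>" "\<bar>r z\<bar> \<le> 10 * \<bar>z\<bar>"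
    using float_rounding_sgn_bounds[OF assms, of z] float_rounding_0[OF assms(1)]
    by (cases "z = 0"; simp add: eq)+
qed simp

lemma dec_exponent_unique:
  assumes "10 powi (e - 1) \<le> \<bar>z\<bar>" and "\<bar>z\<bar> < 10 powi e"
  shows "dec_exponent z = e"
proof -
  have "(10::real) powi (e - 1) > 0" by simp
  then have z: "z \<noteq> 0" using assms(1) by linarith
  have lt: "a \<le> b" if "(10::real) powi (a - 1) \<le> y" "y < 10 powi b" for a b :: int and y :: real
  proof (rule ccontr)
    assume "\<not> a \<le> b"
    then have "(10::real) powi b \<le> 10 powi (a - 1)"
      by (intro power_int_increasing) auto
    then show False using that by linarith
  qed
  show ?thesis
    using lt assms dec_exponent_bounds[OF z] by (meson order_antisym)
qed

lemma dec_exponent_scale: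
  assumes "z \<noteq> 0"
  shows "dec_exponent (10 powi a * z) = dec_exponent z + a"
proof (rule dec_exponent_unique)
  have pos: "(10::real) powi a > 0" by simp
  have abs: "\<bar>10 powi a * z\<bar> = 10 powi a * \<bar>z\<bar>" by (simp add: abs_mult)
  have "10 powi a * 10 powi (dec_exponent z - 1) \<le> 10 powi a * \<bar>z\<bar>"
    using dec_exponent_bounds(1)[OF assms] pos by (intro mult_left_mono) auto
  moreover have "10 powi a * 10 powi (dec_exponent z - 1) = (10::real) powi (dec_exponent z + a - 1)"
    by (subst power_int_add [symmetric]) (auto simp: algebra_simps)
  ultimately show "10 powi (dec_exponent z + a - 1) \<le> \<bar>10 powi a * z\<bar>" using abs by simp
  have "10 powi a * \<bar>z\<bar> < 10 powi a * 10 powi dec_exponent z"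
    using dec_exponent_bounds(2)[OF assms] pos by (intro mult_strict_left_mono) auto
  moreover have "10 powi a * 10 powi dec_exponent z = (10::real) powi (dec_exponent z + a)"
    by (subst power_int_add [symmetric]) (auto simp: algebra_simps)
  ultimately show "\<bar>10 powi a * z\<bar> < 10 powi (dec_exponent z + a)" using abs by simp
qed

lemma dec_exponent_first_digits:
  assumes "z \<noteq> 0"
  shows "dec_exponent (first_digits (p + 1) z) = dec_exponent z"
proof (rule dec_exponent_unique)
  have "(10::real) powi (dec_exponent z - 1) > 0" by simp
  then have "sgn z * first_digits (p + 1) z > 0"
    using sgn_first_digits_bounds(1)[OF assms, of p] by linarith
  then have "\<bar>first_digits (p + 1) z\<bar> = sgn z * first_digits (p + 1) z"
    by (auto simp: sgn_if split: if_splits)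
  then show "10 powi (dec_exponent z - 1) \<le> \<bar>first_digits (p + 1) z\<bar>"
    "\<bar>first_digits (p + 1) z\<bar> < 10 powi dec_exponent z"
    using sgn_first_digits_bounds[OF assms, of p] dec_exponent_bounds[OF assms] by linarith+
qed

lemma sgn_first_digits: "sgn (first_digits (p + 1) z) = sgn z"
proof (cases "z = 0")
  case False
  have "(10::real) powi (dec_exponent z - 1) > 0" by simp
  then have "sgn z * first_digits (p + 1) z > 0"
    using sgn_first_digits_bounds(1)[OF False, of p] by linarith
  then show ?thesis by (auto simp: sgn_if split: if_splits)
qed simp

lemma float_numbers_cases:
  assumes "w \<in> float_numbers p"
  shows "(\<exists>k::int. w = k * 10 powi (e - int p)) \<or> \<bar>w\<bar> < 10 powi (e - 1)"
proof -
  obtain s m a n where w: "w = s * m * 10 powi a" "s \<in> {-1, 1}" "m = 0 \<or> 1/10 \<le> m \<and> m < 1"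
    "m = real n / 10 ^ p"
    using assms unfolding float_numbers_def by blast
  show ?thesis
  proof (cases "e \<le> a")
    case True
    have "(10::real) powi a = 10 ^ p * 10 ^ nat (a - e) * 10 powi (e - int p)"
    proof -
      have "(10::real) powi a = 10 powi (int p + int (nat (a - e)) + (e - int p))"
        using True by simp
      also have "\<dots> = 10 ^ p * 10 ^ nat (a - e) * 10 powi (e - int p)"
        by (subst power_int_add, simp, subst power_int_add, simp) (simp only: power_int_of_nat)
      finally show ?thesis .
    qed
    then have "w = s * real n * 10 ^ nat (a - e) * 10 powi (e - int p)"
      using w by simp
    moreover obtain s' :: int where "s = of_int s'" using w(2) by (metis insertE of_int_1 of_int_minus singletonD)
    ultimately have "w = of_int (s' * int n * 10 ^ nat (a - e)) * 10 powi (e - int p)" by simp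
    then show ?thesis by blast
  next
    case False
    have "\<bar>w\<bar> = m * 10 powi a" using w by (auto simp: abs_mult)
    also have "\<dots> < 1 * 10 powi a" using w(3) by (intro mult_strict_right_mono) auto
    also have "1 * 10 powi a \<le> (10::real) powi (e - 1)"
      using False by (simp add: power_int_increasing)
    finally show ?thesis by blast
  qed
qed

lemma float_numbersI:
  fixes k :: int
  assumes p: "p \<ge> 1" and s: "s \<in> {-1, 1}" and k: "10 ^ (p - 1) \<le> k" "k \<le> 10 ^ p"
  shows "s * of_int k * 10 powi (e - int p) \<in> float_numbers p"
proof (cases "k = 10 ^ p")
  case True
  then have "of_int k * 10 powi (e - int p) = (10::real) powi e"
    by (simp add: power_int_diff)
  then show ?thesis using power_10_in_float_numbers[OF p s, of e] by (simp add: mult.assoc)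
next
  case False
  then have k': "k < 10 ^ p" using k by simp
  define m :: real where "m = of_int k / 10 ^ p"
  have "real_of_int (10 ^ (p - 1)) \<le> of_int k" using k(1) by (simp only: of_int_le_iff)
  then have m1: "1/10 \<le> m"
    using p unfolding m_def by (cases p) (auto simp: field_simps)
  have "real_of_int k < of_int (10 ^ p)" using k' by (simp only: of_int_less_iff)
  then have m2: "m < 1" unfolding m_def by simp
  have "0 \<le> k" using k(1) by (meson order_trans zero_le_numeral zero_le_power)
  then have m3: "m = real (nat k) / 10 ^ p" unfolding m_def by simp
  have "s * of_int k * 10 powi (e - int p) = s * m * 10 powi e"
    unfolding m_def by (simp add: power_int_diff)
  then show ?thesis unfolding float_numbers_def using s m1 m2 m3 by blast
qed

text \<open>Rounding ties away from zero is a floating-point rounding.\<close>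

lemma float_rounding_exists:
  assumes p: "p \<ge> 1"
  shows "\<exists>r. float_rounding p r"
proof -
  define N where "N z = \<lfloor>\<bar>z\<bar> * 10 powi (int (p + 1) - dec_exponent z)\<rfloor>" for z :: real
  define K where "K z = (N z + 5) div 10" for z
  define r where "r z = sgn z * of_int (K z) * 10 powi (dec_exponent z - int p)" for z
  have T: "first_digits (p + 1) z = sgn z * of_int (N z) * 10 powi (dec_exponent z - int (p + 1))" for z
    unfolding first_digits_def N_def ..
  have p_pow: "(10::int) ^ p = 10 * 10 ^ (p - 1)" using p by (cases p) auto
  have N_bounds: "10 ^ p \<le> N z" "N z < 10 * 10 ^ p" if z: "z \<noteq> 0" for z
  proof -
    let ?u = "(10::real) powi (int (p + 1) - dec_exponent z)"
    have "10 powi (dec_exponent z - 1) * ?u \<le> \<bar>z\<bar> * ?u"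
      using dec_exponent_bounds(1)[OF z] by (intro mult_right_mono) auto
    moreover have "10 powi (dec_exponent z - 1) * ?u = of_int (10 ^ p)"
      by (subst power_int_add [symmetric]) (auto simp: power_int_def)
    ultimately show "10 ^ p \<le> N z" unfolding N_def by (simp only: le_floor_iff)
    have "\<bar>z\<bar> * ?u < 10 powi dec_exponent z * ?u"
      using dec_exponent_bounds(2)[OF z] by (intro mult_strict_right_mono) auto
    moreover have "10 powi dec_exponent z * ?u = of_int (10 * 10 ^ p)"
      by (subst power_int_add [symmetric]) (auto simp: power_int_def nat_add_distrib)
    ultimately show "N z < 10 * 10 ^ p" unfolding N_def by (simp only: floor_less_iff)
  qed
  have float: "r z \<in> float_numbers p" for z
  proof (cases "z = 0")
    case False
    have "sgn z \<in> {-1, 1}" using False by (auto simp: sgn_if)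
    moreover have "10 ^ (p - 1) \<le> K z" "K z \<le> 10 ^ p"
      using N_bounds[OF False] p_pow unfolding K_def by linarith+
    ultimately show ?thesis unfolding r_def by (intro float_numbersI[OF p])
  qed (simp add: r_def zero_in_float_numbers)
  have closest: "\<bar>r z - first_digits (p + 1) z\<bar> \<le> \<bar>w - first_digits (p + 1) z\<bar>"
    if w: "w \<in> float_numbers p" for z w
  proof (cases "z = 0")
    case False
    define g where "g = (10::real) powi (dec_exponent z - int (p + 1))"
    have g: "g > 0" unfolding g_def by simp
    have g10: "10 powi (dec_exponent z - int p) = 10 * g"
      unfolding g_def by (simp add: power_int_diff power_int_add)
    have s: "sgn z * sgn z = 1" "\<bar>sgn z\<bar> = 1" using False by (auto simp: sgn_if)
    have absT: "\<bar>y - first_digits (p + 1) z\<bar> = \<bar>sgn z * y - of_int (N z) * g\<bar>" for y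
      unfolding T g_def[symmetric] using False by (auto simp: sgn_if)
    have rz: "\<bar>r z - first_digits (p + 1) z\<bar> = of_int \<bar>10 * K z - N z\<bar> * g"
    proof -
      have "sgn z * r z - of_int (N z) * g = of_int (10 * K z - N z) * g"
        unfolding r_def g10 using False by (auto simp: sgn_if algebra_simps)
      then show ?thesis unfolding absT using g by (simp add: abs_mult)
    qed
    have K: "\<bar>10 * K z - N z\<bar> \<le> \<bar>10 * k - N z\<bar>" for k
    proof -
      have "10 * K z \<le> N z + 5" "N z + 5 < 10 * K z + 10" unfolding K_def by presburger+
      then show ?thesis by presburger
    qed
    have mult: "of_int \<bar>10 * K z - N z\<bar> * g \<le> \<bar>of_int k * (10 * g) - of_int (N z) * g\<bar>" for k :: int
    proof -
      have "of_int k * (10 * g) - of_int (N z) * g = of_int (10 * k - N z) * g"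
        by (simp add: algebra_simps)
      then have "\<bar>of_int k * (10 * g) - of_int (N z) * g\<bar> = of_int \<bar>10 * k - N z\<bar> * g"
        using g by (simp add: abs_mult)
      moreover have "real_of_int \<bar>10 * K z - N z\<bar> * g \<le> of_int \<bar>10 * k - N z\<bar> * g"
        using K[of k] g by (intro mult_right_mono) (auto simp only: of_int_le_iff less_imp_le)
      ultimately show ?thesis by simp
    qed
    from float_numbers_cases[OF w, of "dec_exponent z"] show ?thesis
    proof
      assume "\<exists>k::int. w = k * 10 powi (dec_exponent z - int p)"
      then obtain k :: int where k: "w = k * (10 * g)" using g10 by auto
      have "sgn z = of_int (if 0 < z then 1 else -1)" using False by (simp add: sgn_if)
      then obtain s' :: int where s': "sgn z = of_int s'" by blast
      have "sgn z * w = of_int (s' * k) * (10 * g)" using k s' by simp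
      then show ?thesis unfolding rz absT[of w] using mult[of "s' * k"] by simp
    next
      assume lt: "\<bar>w\<bar> < 10 powi (dec_exponent z - 1)"
      have g1: "10 powi (dec_exponent z - 1) = of_int (10 ^ (p - 1)) * (10 * g)"
      proof -
        have "(10::real) powi (dec_exponent z - 1) = 10 powi int (p - 1) * 10 powi (dec_exponent z - int p)"
          using p by (subst power_int_add [symmetric]) (auto simp: of_nat_diff)
        then show ?thesis using g10 by simp
      qed
      have "10 powi (dec_exponent z - 1) \<le> of_int (N z) * g"
        using sgn_first_digits_bounds(1)[OF False, of p] False unfolding T g_def
        by (auto simp: sgn_if split: if_splits)
      moreover have "\<bar>sgn z * w\<bar> < 10 powi (dec_exponent z - 1)" using lt s by (simp add: abs_mult)
      ultimately show ?thesis unfolding rz absT[of w] using mult[of "10 ^ (p - 1)"] g1 by linarith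
    qed
  qed (simp add: r_def)
  have digits: "r z = r z'" if eq: "first_digits (p + 1) z = first_digits (p + 1) z'" for z z'
  proof (cases "z = 0")
    case True
    then have "sgn z' = 0" using eq sgn_first_digits[of p z'] by simp
    then show ?thesis using True by (simp add: r_def)
  next
    case False
    have s: "sgn z = sgn z'" using eq sgn_first_digits by metis
    then have z': "z' \<noteq> 0" using False by (metis sgn_0 sgn_0_0)
    have e: "dec_exponent z = dec_exponent z'"
      using eq dec_exponent_first_digits False z' by metis
    have "sgn z' * of_int (N z) * 10 powi (dec_exponent z' - int (p + 1)) =
          sgn z' * of_int (N z') * 10 powi (dec_exponent z' - int (p + 1))"
      using eq unfolding T s e .
    then have "N z = N z'" using z' by (simp add: sgn_0_0)
    then show ?thesis unfolding r_def K_def using s e by simp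
  qed
  have scale: "r (10 powi a * z) = 10 powi a * r z" for a z
  proof (cases "z = 0")
    case False
    have "10 powi a * 10 powi (int (p + 1) - (dec_exponent z + a)) =
          (10::real) powi (int (p + 1) - dec_exponent z)"
      by (subst power_int_add [symmetric]) (auto simp: algebra_simps)
    then have "\<bar>10 powi a * z\<bar> * 10 powi (int (p + 1) - (dec_exponent z + a)) =
       \<bar>z\<bar> * 10 powi (int (p + 1) - dec_exponent z)"
      by (simp add: abs_mult mult_ac)
    then have N: "N (10 powi a * z) = N z"
      unfolding N_def dec_exponent_scale[OF False] by simp
    have "(10::real) powi (dec_exponent z + a - int p) = 10 powi a * 10 powi (dec_exponent z - int p)"
      by (subst power_int_add [symmetric]) (auto simp: algebra_simps)
    moreover have "sgn (10 powi a * z) = sgn z" by (simp add: sgn_mult)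
    ultimately show ?thesis unfolding r_def K_def N dec_exponent_scale[OF False] by simp
  qed (simp add: r_def)
  have "float_rounding p r"
    unfolding float_rounding_def is_arg_min_def
    using float closest digits scale by (meson linorder_not_le)
  then show ?thesis by blast
qed

end

theory Submission
  imports Defs
begin

text \<open>Every component of the orbit is eventually geometric along arithmetic progressions of times:
  on each residue class it is multiplied by a fixed power of 10 per period. Polynomials evaluated
  along the orbit then become polynomials in \<open>10 ^ k\<close>, divided by a power of \<open>10 ^ k\<close>, so their signs
  are eventually constant on each residue class and the hitting set is eventually periodic.

  Passing to a power of the step map, the relation \<open>E\<close> of which component feeds which is idempotent.
  A component \<open>i\<close> then lies in a clique \<open>D\<close> of \<open>E\<close> (or is only fed by others), whose
  remaining inputs are geometric by induction. One step makes all members of \<open>D\<close> comparable in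
  size, up to a constant, unless the inputs dominate, so up to a power of 10 only finitely many
  states of \<open>D\<close> occur. Since truncation is continuous from the right, inputs that are
  sufficiently small compared to \<open>D\<close> have no effect at all. Relative to the growth of the
  fastest input, either \<open>D\<close> is eventually large, hence autonomous, and its state recurs up to a
  power of 10; or \<open>D\<close> returns infinitely often to a bounded region, and its state recurs exactly.\<close>

section \<open>Rounding\<close>

text \<open>Truncation rounds magnitudes down, so on the positive axis its steps are half-open
  intervals closed on the left: a small move to the right crosses neither a power of 10 nor a floor
  threshold.\<close>

lemma first_digits_right_constant:
  assumes "z > 0"
  shows "\<exists>\<delta>>0. \<forall>z'. z \<le> z' \<and> z' \<le> z + \<delta> \<longrightarrow> first_digits k z' = first_digits k z"
proof -
  define e where "e = dec_exponent z"
  define P where "P = (10::real) powi (int k - e)"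
  \<comment> \<open>Half the distance to the next power of 10, and half the distance to the next
    multiple of \<open>1 / P\<close>; halving keeps both inequalities strict.\<close>
  define \<delta> where "\<delta> = min ((10 powi e - z) / 2) ((of_int \<lfloor>z * P\<rfloor> + 1 - z * P) / (2 * P))"
  have P: "P > 0" by (simp add: P_def)
  have z: "10 powi (e - 1) \<le> z" "z < 10 powi e"
    using dec_exponent_bounds[of z] assms by (simp_all add: e_def)
  have fl: "z * P < of_int \<lfloor>z * P\<rfloor> + 1" by linarith
  have "\<delta> > 0" using z fl P by (simp add: \<delta>_def)
  moreover have "first_digits k z' = first_digits k z" if z': "z \<le> z'" "z' \<le> z + \<delta>" for z'
  proof -
    have "z' \<le> z + (10 powi e - z) / 2"
      using z'(2) unfolding \<delta>_def by linarith
    then have "z' < 10 powi e" using z(2) by argo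
    then have e': "dec_exponent z' = e"
      using z z' assms by (intro dec_exponent_unique) auto
    have "z' * P \<le> (z + (of_int \<lfloor>z * P\<rfloor> + 1 - z * P) / (2 * P)) * P"
      using z'(2) P unfolding \<delta>_def by (intro mult_right_mono) auto
    also have "\<dots> = z * P + (of_int \<lfloor>z * P\<rfloor> + 1 - z * P) / 2"
      using P by (simp add: field_simps)
    finally have "z' * P < of_int \<lfloor>z * P\<rfloor> + 1" using fl by argo
    moreover have "z * P \<le> z' * P" using z' P by (intro mult_right_mono) auto
    ultimately have "\<lfloor>z' * P\<rfloor> = \<lfloor>z * P\<rfloor>" by linarith
    then show ?thesis
      using e' z' assms by (simp add: first_digits_def P_def e_def)
  qed
  ultimately show ?thesis by blast
qed

lemma float_rounding_right_constant:
  assumes "float_rounding p r" "z > 0"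
  shows "\<exists>\<delta>>0. \<forall>z'. z \<le> z' \<and> z' \<le> z + \<delta> \<longrightarrow> r z' = r z"
proof -
  obtain \<delta> where "\<delta> > 0"
    and \<delta>: "\<forall>z'. z \<le> z' \<and> z' \<le> z + \<delta> \<longrightarrow> first_digits (p + 1) z' = first_digits (p + 1) z"
    using first_digits_right_constant[OF assms(2)] by blast
  have "r z' = r z" if "z \<le> z'" "z' \<le> z + \<delta>" for z'
    using that \<delta> assms(1) unfolding float_rounding_def by blast
  with \<open>\<delta> > 0\<close> show ?thesis by blast
qed

lemma float_rounding_nonneg_bounds:
  assumes "float_rounding p r" "p \<ge> 1" "z \<ge> 0"
  shows "z / 10 \<le> r z" "r z \<le> 2 * z"
  using float_rounding_sgn_bounds[OF assms(1,2), of z] float_rounding_0[OF assms(1)] assms(3)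
  by (cases "z = 0"; simp)+

lemma float_rounding_in_float_numbers:
  "float_rounding p r \<Longrightarrow> r z \<in> float_numbers p"
  unfolding float_rounding_def is_arg_min_def by blast

lemma float_numbers_scale:
  assumes "w \<in> float_numbers p"
  shows "10 powi a * w \<in> float_numbers p"
proof -
  obtain s m \<alpha> where w: "w = s * m * 10 powi \<alpha>" "s \<in> {-1, 1}"
    "m = 0 \<or> 1/10 \<le> m \<and> m < 1" "\<exists>n::nat. m = real n / 10 ^ p"
    using assms unfolding float_numbers_def by blast
  have "10 powi a * w = s * m * 10 powi (\<alpha> + a)"
    by (simp add: w(1) power_int_add)
  then show ?thesis using w(2-4) unfolding float_numbers_def by blast
qed

section \<open>Floating-point numbers in a bounded positive range\<close>

lemma dec_exponent_mono:
  assumes "0 < x" "x \<le> y"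
  shows "dec_exponent x \<le> dec_exponent y"
  using assms by (auto simp: dec_exponent_def intro!: floor_mono)

text \<open>Floating-point numbers can accumulate only at 0. Above \<open>a > 0\<close> the exponent
  lies between those of \<open>a\<close> and \<open>b\<close>, and the mantissa has at most
  \<open>10 ^ p\<close> values.\<close>

lemma finite_float_numbers_between:
  assumes "a > 0"
  shows "finite {w \<in> float_numbers p. a \<le> w \<and> w \<le> b}"
proof (rule finite_subset)
  show "finite ((\<lambda>(n, \<alpha>). real n / 10 ^ p * 10 powi \<alpha>) `
    ({..<10 ^ p} \<times> {dec_exponent a..dec_exponent b}))" by simp
  show "{w \<in> float_numbers p. a \<le> w \<and> w \<le> b} \<subseteq> (\<lambda>(n, \<alpha>). real n / 10 ^ p * 10 powi \<alpha>) `
    ({..<10 ^ p} \<times> {dec_exponent a..dec_exponent b})"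
  proof safe
    fix w assume w: "w \<in> float_numbers p" "a \<le> w" "w \<le> b"
    obtain s m \<alpha> n where s: "w = s * m * 10 powi \<alpha>" "s \<in> {-1, 1}"
      and m: "m = 0 \<or> 1/10 \<le> m \<and> m < 1" and n: "m = real n / 10 ^ p"
      using w unfolding float_numbers_def by blast
    have "w > 0" using assms w by linarith
    have "m \<noteq> 0" using s \<open>w > 0\<close> by auto
    then have m: "1/10 \<le> m" "m < 1" using m by auto
    have "m * 10 powi \<alpha> > 0" using m by simp
    then have "s = 1" using s \<open>w > 0\<close> by auto
    then have w_eq: "w = m * 10 powi \<alpha>" using s by simp
    have "1/10 * 10 powi \<alpha> \<le> m * 10 powi \<alpha>" "m * 10 powi \<alpha> < 1 * 10 powi \<alpha>"
      using m by (intro mult_right_mono mult_strict_right_mono; simp)+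
    then have "dec_exponent w = \<alpha>"
      using \<open>w > 0\<close> by (intro dec_exponent_unique) (auto simp: w_eq power_int_diff)
    then have "\<alpha> \<in> {dec_exponent a..dec_exponent b}"
      using dec_exponent_mono[of a w] dec_exponent_mono[of w b] w assms \<open>w > 0\<close> by auto
    moreover have "n < 10 ^ p"
    proof -
      have "real n < real (10 ^ p)" using m(2) n by (simp add: field_simps)
      then show ?thesis by (simp only: of_nat_less_iff)
    qed
    ultimately show "w \<in> (\<lambda>(n, \<alpha>). real n / 10 ^ p * 10 powi \<alpha>) `
      ({..<10 ^ p} \<times> {dec_exponent a..dec_exponent b})"
      by (intro image_eqI[of _ _ "(n, \<alpha>)"]) (auto simp: w_eq n)
  qed
qed

lemma uniform_positive_bound:
  fixes P :: "'a \<Rightarrow> real \<Rightarrow> bool"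
  assumes "finite A" and "\<And>x. x \<in> A \<Longrightarrow> \<exists>e>0. P x e"
    and "\<And>x e e'. P x e \<Longrightarrow> 0 < e' \<Longrightarrow> e' \<le> e \<Longrightarrow> P x e'"
  shows "\<exists>e>0. \<forall>x\<in>A. P x e"
  using assms(1,2)
proof (induction A)
  case empty
  show ?case by (auto intro: exI[of _ 1])
next
  case (insert x A)
  obtain e where e: "e > 0" "\<forall>x\<in>A. P x e" using insert by auto
  obtain e' where e': "e' > 0" "P x e'" using insert by auto
  show ?case
    using e e' by (intro exI[of _ "min e e'"]) (auto intro: assms(3))
qed

section \<open>Rounded positive maps\<close>

text \<open>Maps on the non-negative orthant that share the relevant features of one step of the rounded
  dynamics and are closed under composition; a pair \<open>(j, i)\<close> in \<open>E\<close> says that the \<open>j\<close>-th argument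
  contributes to the \<open>i\<close>-th value. The last assumption reflects that truncation is continuous from
  the right: increments that are small enough cannot cause a carry.\<close>

locale rounded_map =
  fixes p :: nat and E :: "('n::finite \<times> 'n) set" and f :: "('n \<Rightarrow> real) \<Rightarrow> 'n \<Rightarrow> real"
  assumes float: "f v i \<in> float_numbers p"
    and nonneg: "(\<And>j. 0 \<le> v j) \<Longrightarrow> 0 \<le> f v i"
    and cong: "(\<And>j. (j, i) \<in> E \<Longrightarrow> u j = v j) \<Longrightarrow> f u i = f v i"
    and scale: "f (\<lambda>j. 10 powi a * v j) i = 10 powi a * f v i"
    and lower: "(j, i) \<in> E \<Longrightarrow> \<exists>c>0. \<forall>v. (\<forall>k. 0 \<le> v k) \<longrightarrow> c * v j \<le> f v i"
    and upper: "\<exists>C>0. \<forall>v B. (\<forall>j. 0 \<le> v j) \<longrightarrow> (\<forall>j. (j, i) \<in> E \<longrightarrow> v j \<le> B) \<longrightarrow> 0 \<le> B \<longrightarrow> f v i \<le> C * B"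
    and right: "(\<And>j. 0 \<le> v j) \<Longrightarrow> 0 < f v i \<Longrightarrow>
      \<exists>e>0. \<forall>u. (\<forall>j. v j \<le> u j \<and> u j \<le> v j + e) \<longrightarrow> f u i = f v i"

text \<open>Rounding keeps a non-negative \<open>z\<close> between \<open>z / 10\<close> and
  \<open>2 * z\<close>, so one summand gives the lower bound and the row sum the upper one;
  right-constancy of rounding gives the last assumption.\<close>

lemma rounded_map_matrix:
  fixes M :: "real ^ 'n ^ 'n"
  assumes p: "p \<ge> 1" and r: "float_rounding p r" and M: "\<And>i j. 0 \<le> M $ i $ j"
  shows "rounded_map p {(j, i). 0 < M $ i $ j} (\<lambda>v i. r (\<Sum>j\<in>UNIV. M $ i $ j * v j))"
proof
  fix v :: "'n \<Rightarrow> real" and i :: 'n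
  let ?z = "\<lambda>v i. \<Sum>j\<in>UNIV. M $ i $ j * v j"
  have z: "0 \<le> ?z v i" if "\<And>j. 0 \<le> v j" for v i
    using that M by (intro sum_nonneg) auto
  have b: "?z v i / 10 \<le> r (?z v i)" "r (?z v i) \<le> 2 * ?z v i" if "\<And>j. 0 \<le> v j" for v i
    by (intro float_rounding_nonneg_bounds[OF r p] z that)+
  show "r (?z v i) \<in> float_numbers p" by (rule float_rounding_in_float_numbers[OF r])
  show "0 \<le> r (?z v i)" if v: "\<And>j. 0 \<le> v j"
    using b(1)[of v i] z[of v i] v by simp
  show "r (?z u i) = r (?z v i)" if "\<And>j. (j, i) \<in> {(j, i). 0 < M $ i $ j} \<Longrightarrow> u j = v j" for u
  proof -
    have "M $ i $ j * u j = M $ i $ j * v j" for j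
      using that[of j] M[of i j] by (cases "M $ i $ j = 0") auto
    then show ?thesis by (simp only:)
  qed
  show "r (?z (\<lambda>j. 10 powi a * v j) i) = 10 powi a * r (?z v i)" for a
  proof -
    have "?z (\<lambda>j. 10 powi a * v j) i = 10 powi a * ?z v i"
      by (simp add: sum_distrib_left mult_ac)
    moreover have "r (10 powi a * ?z v i) = 10 powi a * r (?z v i)"
      using r unfolding float_rounding_def by blast
    ultimately show ?thesis by (simp only:)
  qed
  show "\<exists>c>0. \<forall>v. (\<forall>k. 0 \<le> v k) \<longrightarrow> c * v j \<le> r (?z v i)"
    if "(j, i) \<in> {(j, i). 0 < M $ i $ j}" for j
  proof (intro exI[of _ "M $ i $ j / 10"] conjI allI impI)
    fix v :: "'n \<Rightarrow> real" assume v: "\<forall>k. 0 \<le> v k"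
    have "M $ i $ j * v j \<le> ?z v i"
      using v M by (intro member_le_sum) auto
    then show "M $ i $ j / 10 * v j \<le> r (?z v i)"
      using b(1)[of v i] v by (simp add: field_simps)
  qed (use that in auto)
  show "\<exists>C>0. \<forall>v B. (\<forall>j. 0 \<le> v j) \<longrightarrow> (\<forall>j. (j, i) \<in> {(j, i). 0 < M $ i $ j} \<longrightarrow> v j \<le> B) \<longrightarrow> 0 \<le> B \<longrightarrow>
    r (?z v i) \<le> C * B"
  \<comment> \<open>The \<open>+ 1\<close> keeps the constant positive when row \<open>i\<close>
    vanishes.\<close>
  proof (intro exI[of _ "2 * (\<Sum>j\<in>UNIV. M $ i $ j) + 1"] conjI allI impI)
    have S: "0 \<le> (\<Sum>j\<in>UNIV. M $ i $ j)" using M by (intro sum_nonneg)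
    then show "0 < 2 * (\<Sum>j\<in>UNIV. M $ i $ j) + 1" by linarith
    fix v :: "'n \<Rightarrow> real" and B
    assume v: "\<forall>j. 0 \<le> v j" "\<forall>j. (j, i) \<in> {(j, i). 0 < M $ i $ j} \<longrightarrow> v j \<le> B" "0 \<le> B"
    have "M $ i $ j * v j \<le> M $ i $ j * B" for j
      using v(2) M[of i j] by (cases "M $ i $ j = 0") (auto intro: mult_left_mono)
    then have "?z v i \<le> (\<Sum>j\<in>UNIV. M $ i $ j * B)" by (intro sum_mono)
    also have "\<dots> = (\<Sum>j\<in>UNIV. M $ i $ j) * B" by (simp add: sum_distrib_right)
    finally show "r (?z v i) \<le> (2 * (\<Sum>j\<in>UNIV. M $ i $ j) + 1) * B"
      using b(2)[of v i] v by (simp add: algebra_simps)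
  qed
  show "\<exists>e>0. \<forall>u. (\<forall>j. v j \<le> u j \<and> u j \<le> v j + e) \<longrightarrow> r (?z u i) = r (?z v i)"
    if v: "\<And>j. 0 \<le> v j" and pos: "0 < r (?z v i)"
  proof -
    have "?z v i > 0" using b(2)[of v i] v pos by simp
    then obtain \<delta> where \<delta>: "\<delta> > 0" "\<forall>z'. ?z v i \<le> z' \<and> z' \<le> ?z v i + \<delta> \<longrightarrow> r z' = r (?z v i)"
      using float_rounding_right_constant[OF r] by blast
    define S where "S = (\<Sum>j\<in>UNIV. M $ i $ j)"
    have S: "0 \<le> S" unfolding S_def using M by (intro sum_nonneg)
    show ?thesis
    \<comment> \<open>Raising every argument by at most \<open>e\<close> raises the sum by at most
      \<open>S * e\<close>, which this choice keeps within \<delta>.\<close>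
    proof (intro exI[of _ "\<delta> / (S + 1)"] conjI allI impI)
      show "0 < \<delta> / (S + 1)" using \<delta> S by simp
      fix u :: "'n \<Rightarrow> real" assume u: "\<forall>j. v j \<le> u j \<and> u j \<le> v j + \<delta> / (S + 1)"
      have "?z v i \<le> ?z u i" using u M by (intro sum_mono mult_left_mono) auto
      moreover have "?z u i \<le> (\<Sum>j\<in>UNIV. M $ i $ j * (v j + \<delta> / (S + 1)))"
        using u M by (intro sum_mono mult_left_mono) auto
      moreover have "(\<Sum>j\<in>UNIV. M $ i $ j * (v j + \<delta> / (S + 1))) = ?z v i + S * (\<delta> / (S + 1))"
        by (simp only: distrib_left sum.distrib S_def sum_distrib_right)
      moreover have "S * (\<delta> / (S + 1)) \<le> \<delta>" using \<delta> S by (simp add: field_simps)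
      ultimately have "?z v i \<le> ?z u i \<and> ?z u i \<le> ?z v i + \<delta>" by linarith
      then show "r (?z u i) = r (?z v i)" using \<delta>(2) by blast
    qed
  qed
qed

section \<open>Closure of rounded maps under composition, iteration and rescaling\<close>

lemma rounded_map_comp:
  assumes "rounded_map p E f" "rounded_map p E' f'"
  shows "rounded_map p (E' O E) (\<lambda>v. f (f' v))"
proof -
  interpret f: rounded_map p E f by fact
  interpret f': rounded_map p E' f' by fact
  show ?thesis
  proof
    fix v :: "'a \<Rightarrow> real" and i :: 'a
    show "f (f' v) i \<in> float_numbers p" by (rule f.float)
    show "0 \<le> f (f' v) i" if "\<And>j. 0 \<le> v j"
      using that by (intro f.nonneg f'.nonneg)
    show "f (f' u) i = f (f' v) i" if "\<And>j. (j, i) \<in> E' O E \<Longrightarrow> u j = v j" for u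
      using that by (intro f.cong f'.cong) blast
    show "f (f' (\<lambda>j. 10 powi a * v j)) i = 10 powi a * f (f' v) i" for a
    proof -
      have "f' (\<lambda>j. 10 powi a * v j) = (\<lambda>j. 10 powi a * f' v j)"
        using f'.scale by auto
      then show ?thesis using f.scale by simp
    qed
    show "\<exists>c>0. \<forall>v. (\<forall>k. 0 \<le> v k) \<longrightarrow> c * v j \<le> f (f' v) i" if "(j, i) \<in> E' O E" for j
    proof -
      obtain k where k: "(j, k) \<in> E'" "(k, i) \<in> E" using \<open>(j, i) \<in> E' O E\<close> by blast
      obtain c where c: "c > 0" "\<forall>v. (\<forall>l. 0 \<le> v l) \<longrightarrow> c * v k \<le> f v i"
        using f.lower[OF k(2)] by blast
      obtain c' where c': "c' > 0" "\<forall>v. (\<forall>l. 0 \<le> v l) \<longrightarrow> c' * v j \<le> f' v k"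
        using f'.lower[OF k(1)] by blast
      show ?thesis
      proof (intro exI[of _ "c * c'"] conjI allI impI)
        fix v :: "'a \<Rightarrow> real" assume v: "\<forall>k. 0 \<le> v k"
        have "c * (c' * v j) \<le> c * f' v k" using c c' v by (intro mult_left_mono) auto
        also have "\<dots> \<le> f (f' v) i" using c(2) v f'.nonneg by auto
        finally show "c * c' * v j \<le> f (f' v) i" by (simp add: mult.assoc)
      qed (use c c' in auto)
    qed
    show "\<exists>C>0. \<forall>v B. (\<forall>j. 0 \<le> v j) \<longrightarrow> (\<forall>j. (j, i) \<in> E' O E \<longrightarrow> v j \<le> B) \<longrightarrow> 0 \<le> B \<longrightarrow>
      f (f' v) i \<le> C * B"
    proof -
      obtain C where C: "C > 0"
        "\<And>v B. (\<forall>j. 0 \<le> v j) \<Longrightarrow> (\<forall>j. (j, i) \<in> E \<longrightarrow> v j \<le> B) \<Longrightarrow> 0 \<le> B \<Longrightarrow> f v i \<le> C * B"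
        using f.upper[of i] by blast
      obtain C' where C': "\<And>k. C' k > 0"
        "\<And>k v B. (\<forall>j. 0 \<le> v j) \<Longrightarrow> (\<forall>j. (j, k) \<in> E' \<longrightarrow> v j \<le> B) \<Longrightarrow> 0 \<le> B \<Longrightarrow> f' v k \<le> C' k * B"
        using f'.upper by metis
      define S where "S = (\<Sum>k\<in>UNIV. C' k)"
      have S: "C' k \<le> S" for k
        unfolding S_def using C'(1) by (intro member_le_sum) (auto intro: less_imp_le)
      have "S > 0" using S C'(1) by (meson less_le_trans)
      show ?thesis
      proof (intro exI[of _ "C * S"] conjI allI impI)
        show "0 < C * S" using C \<open>S > 0\<close> by simp
        fix v :: "'a \<Rightarrow> real" and B
        assume v: "\<forall>j. 0 \<le> v j" "\<forall>j. (j, i) \<in> E' O E \<longrightarrow> v j \<le> B" "0 \<le> B"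
        have "f' v k \<le> S * B" if "(k, i) \<in> E" for k
        proof -
          have "f' v k \<le> C' k * B" using that v by (intro C'(2)) blast+
          also have "\<dots> \<le> S * B" using S v by (intro mult_right_mono) auto
          finally show ?thesis .
        qed
        then have "f (f' v) i \<le> C * (S * B)"
          using v \<open>S > 0\<close> f'.nonneg by (intro C(2)) auto
        then show "f (f' v) i \<le> C * S * B" by (simp add: mult.assoc)
      qed
    qed
    show "\<exists>e>0. \<forall>u. (\<forall>j. v j \<le> u j \<and> u j \<le> v j + e) \<longrightarrow> f (f' u) i = f (f' v) i"
      if v: "\<And>j. 0 \<le> v j" and pos: "0 < f (f' v) i"
    proof -
      obtain e1 where e1: "e1 > 0"
        "\<forall>u. (\<forall>j. f' v j \<le> u j \<and> u j \<le> f' v j + e1) \<longrightarrow> f u i = f (f' v) i"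
        using f.right[of "f' v" i] f'.nonneg v pos by blast
      \<comment> \<open>The inner values only have to move right by at most the tolerance
        \<open>e1\<close> of the outer map; \<open>Q k e\<close> records this for component
        \<open>k\<close>.\<close>
      define Q where "Q k e \<longleftrightarrow> (\<forall>u. (\<forall>j. v j \<le> u j \<and> u j \<le> v j + e) \<longrightarrow>
        f' v k \<le> f' u k \<and> f' u k \<le> f' v k + e1)" for k e
      have "\<exists>e>0. Q k e" for k
      proof (cases "f' v k > 0")
        case True
        then obtain e where "e > 0" "\<forall>u. (\<forall>j. v j \<le> u j \<and> u j \<le> v j + e) \<longrightarrow> f' u k = f' v k"
          using f'.right[OF v True] by blast
        then show ?thesis using e1(1) unfolding Q_def by (metis less_add_same_cancel1 less_imp_le order_refl)
      next
        \<comment> \<open>A vanishing inner value is not covered by \<open>right\<close>. By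
          \<open>lower\<close> all arguments feeding it are 0, so by \<open>upper\<close>
          perturbations of size \<open>e1 / C\<close> raise it by at most \<open>e1\<close>.\<close>
        case False
        then have zero: "f' v k = 0" using f'.nonneg[OF v] by (meson linorder_not_le order_antisym)
        have v0: "v j = 0" if jk: "(j, k) \<in> E'" for j
        proof -
          obtain c where "c > 0" "c * v j \<le> 0"
            using f'.lower[OF jk] v zero by metis
          then show ?thesis using v[of j] by (simp add: mult_le_0_iff)
        qed
        obtain C where C: "C > 0"
          "\<And>v B. (\<forall>j. 0 \<le> v j) \<Longrightarrow> (\<forall>j. (j, k) \<in> E' \<longrightarrow> v j \<le> B) \<Longrightarrow> 0 \<le> B \<Longrightarrow> f' v k \<le> C * B"
          using f'.upper[of k] by blast
        have "Q k (e1 / C)"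
          unfolding Q_def
        proof (intro allI impI conjI)
          fix u assume u: "\<forall>j. v j \<le> u j \<and> u j \<le> v j + e1 / C"
          have u0: "0 \<le> u j" for j using v[of j] u by (meson order_trans)
          show "f' v k \<le> f' u k" using zero f'.nonneg[OF u0] by simp
          have "f' u k \<le> C * (e1 / C)"
          proof (rule C(2))
            show "\<forall>j. (j, k) \<in> E' \<longrightarrow> u j \<le> e1 / C" using u v0 by (metis add_0)
          qed (use u0 C e1 in auto)
          then show "f' u k \<le> f' v k + e1" using C zero by simp
        qed
        then show ?thesis using C e1 by (intro exI[of _ "e1 / C"]) auto
      qed
      moreover have "Q k e'" if "Q k e" "0 < e'" "e' \<le> e" for k e e'
        unfolding Q_def
      proof (intro allI impI)
        fix u assume u: "\<forall>j. v j \<le> u j \<and> u j \<le> v j + e'"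
        then have "v j \<le> u j \<and> u j \<le> v j + e" for j
          using u[rule_format, of j] that(3) by linarith
        then show "f' v k \<le> f' u k \<and> f' u k \<le> f' v k + e1" using that(1) unfolding Q_def by blast
      qed
      ultimately have "\<exists>e>0. \<forall>k\<in>UNIV. Q k e"
        by (intro uniform_positive_bound) simp_all
      then obtain e where "e > 0" "\<forall>k\<in>UNIV. Q k e" by blast
      then show ?thesis using e1(2) unfolding Q_def by (intro exI[of _ e]) blast
    qed
  qed
qed

lemma rounded_map_funpow:
  assumes "rounded_map p E f" and "q > 0"
  shows "rounded_map p (E ^^ q) (f ^^ q)"
  using assms(2)
proof (induction q rule: nat_induct_non_zero)
  case 1
  show ?case using assms(1) by simp
next
  case (Suc q)
  show ?case
    using rounded_map_comp[OF assms(1) Suc(2)] by (simp add: comp_def)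
qed

text \<open>Used with \<open>a = - G\<close> for the growth rate \<open>G\<close> of the fastest
  input, which turns that input into a constant one.\<close>

lemma rounded_map_scale:
  assumes "rounded_map p E f"
  shows "rounded_map p E (\<lambda>v i. 10 powi a * f v i)"
proof -
  interpret rounded_map p E f by fact
  have pos: "(10::real) powi a > 0" by simp
  show ?thesis
  proof
    fix v :: "'a \<Rightarrow> real" and i :: 'a
    show "10 powi a * f v i \<in> float_numbers p" using float by (rule float_numbers_scale)
    show "0 \<le> 10 powi a * f v i" if "\<And>j. 0 \<le> v j" using nonneg[OF that] by simp
    show "10 powi a * f u i = 10 powi a * f v i" if "\<And>j. (j, i) \<in> E \<Longrightarrow> u j = v j" for u
      using cong[OF that] by simp
    show "10 powi a * f (\<lambda>j. 10 powi b * v j) i = 10 powi b * (10 powi a * f v i)" for b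
      by (simp add: scale)
    show "\<exists>c>0. \<forall>v. (\<forall>k. 0 \<le> v k) \<longrightarrow> c * v j \<le> 10 powi a * f v i" if "(j, i) \<in> E" for j
    proof -
      obtain c where "c > 0" "\<forall>v. (\<forall>k. 0 \<le> v k) \<longrightarrow> c * v j \<le> f v i"
        using lower[OF \<open>(j, i) \<in> E\<close>] by blast
      then show ?thesis
        using pos by (intro exI[of _ "10 powi a * c"]) (simp add: mult.assoc)
    qed
    show "\<exists>C>0. \<forall>v B. (\<forall>j. 0 \<le> v j) \<longrightarrow> (\<forall>j. (j, i) \<in> E \<longrightarrow> v j \<le> B) \<longrightarrow> 0 \<le> B \<longrightarrow>
      10 powi a * f v i \<le> C * B"
    proof -
      obtain C where "C > 0"
        "\<forall>v B. (\<forall>j. 0 \<le> v j) \<longrightarrow> (\<forall>j. (j, i) \<in> E \<longrightarrow> v j \<le> B) \<longrightarrow> 0 \<le> B \<longrightarrow> f v i \<le> C * B"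
        using upper[of i] by blast
      then show ?thesis
        using pos by (intro exI[of _ "10 powi a * C"]) (simp add: mult.assoc)
    qed
    show "\<exists>e>0. \<forall>u. (\<forall>j. v j \<le> u j \<and> u j \<le> v j + e) \<longrightarrow> 10 powi a * f u i = 10 powi a * f v i"
      if "\<And>j. 0 \<le> v j" "0 < 10 powi a * f v i"
      using right[of v i] that pos by (auto simp: zero_less_mult_iff)
  qed
qed

text \<open>A finite type has finitely many relations, so the powers of \<open>E\<close> are
  eventually periodic; a positive multiple of the period that is beyond the preperiod is an
  idempotent exponent.\<close>

lemma idempotent_relpow:
  fixes E :: "('n::finite \<times> 'n) set"
  shows "\<exists>q>0. (E ^^ q) O (E ^^ q) = E ^^ q"
proof -
  have "\<not> inj (\<lambda>n. E ^^ n)"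
    using finite_imageD[of "\<lambda>n. E ^^ n" UNIV] by auto
  then obtain a b where ab: "a < b" "E ^^ a = E ^^ b"
    unfolding inj_def by (metis linorder_neqE_nat)
  define d where "d = b - a"
  have d: "d > 0" "E ^^ (a + d) = E ^^ a" using ab by (auto simp: d_def)
  have step: "E ^^ (a + n + k * d) = E ^^ (a + n)" for n k
  proof (induction k)
    case (Suc k)
    have "E ^^ (a + n + Suc k * d) = E ^^ (a + d) O E ^^ (n + k * d)"
      by (subst relpow_add [symmetric]) (simp add: algebra_simps)
    also have "\<dots> = E ^^ (a + n + k * d)"
      unfolding d(2) by (subst relpow_add [symmetric]) (simp add: algebra_simps)
    finally show ?case using Suc by simp
  qed simp
  define q where "q = (a + 1) * d"
  have "q \<ge> a" using d(1) by (simp add: q_def trans_le_add2)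
  then have "E ^^ (q + q) = E ^^ q"
    using step[of "q - a" "a + 1"] by (simp add: q_def)
  moreover have "q > 0" using d(1) by (simp add: q_def)
  ultimately show ?thesis by (auto simp: relpow_add)
qed

section \<open>Eventually geometric sequences\<close>

definition geometric :: "(nat \<Rightarrow> real) \<Rightarrow> bool" where
  "geometric u \<longleftrightarrow> (\<exists>g::int. \<forall>k. u k = 10 powi (g * int k) * u 0)"

text \<open>The growth rate may depend on the residue class modulo the period.\<close>

definition eventually_geometric :: "(nat \<Rightarrow> real) \<Rightarrow> bool" where
  "eventually_geometric u \<longleftrightarrow> (\<exists>k0 q. q > 0 \<and> (\<forall>t\<ge>k0. geometric (\<lambda>k. u (t + q * k))))"

lemma geometric_subseq:
  assumes "geometric (\<lambda>k. u (t + q * k))"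
  shows "geometric (\<lambda>k. u (t + q * m * k))"
proof -
  obtain g :: int where g: "\<And>k. u (t + q * k) = 10 powi (g * int k) * u (t + q * 0)"
    using assms unfolding geometric_def by blast
  have "u (t + q * m * k) = 10 powi (g * int m * int k) * u (t + q * m * 0)" for k
    using g[of "m * k"] by (simp add: mult.assoc)
  then show ?thesis unfolding geometric_def by blast
qed

lemma eventually_geometric_common:
  assumes "finite I" and "\<And>i. i \<in> I \<Longrightarrow> eventually_geometric (u i)"
  shows "\<exists>k0 q. q > 0 \<and> (\<forall>i\<in>I. \<forall>t\<ge>k0. geometric (\<lambda>k. u i (t + q * k)))"
  using assms
proof (induction I)
  case empty
  show ?case by (auto intro: exI[of _ 1])
next
  case (insert i I)
  obtain k0 q where q: "q > 0" "\<forall>i\<in>I. \<forall>t\<ge>k0. geometric (\<lambda>k. u i (t + q * k))"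
    using insert by auto
  obtain k1 q1 where q1: "q1 > 0" "\<forall>t\<ge>k1. geometric (\<lambda>k. u i (t + q1 * k))"
    using insert.prems[of i] unfolding eventually_geometric_def by auto
  have "geometric (\<lambda>k. u j (t + q * q1 * k))" if "j \<in> insert i I" "t \<ge> max k0 k1" for j t
  proof (cases "j = i")
    case True
    then show ?thesis using q1 geometric_subseq[of "u i" t q1 q] that by (simp add: mult.commute)
  next
    case False
    then show ?thesis using q geometric_subseq[of "u j" t q q1] that by simp
  qed
  then show ?case using q q1 by (intro exI[of _ "max k0 k1"] exI[of _ "q * q1"]) auto
qed

lemma eventually_geometric_recurrence:
  assumes "q > 0" and "\<And>k. k \<ge> k0 \<Longrightarrow> u (k + q) = 10 powi g * u k"
  shows "eventually_geometric u"
proof -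
  have "u (t + q * k) = 10 powi (g * int k) * u (t + q * 0)" if "t \<ge> k0" for t k
  proof (induction k)
    case (Suc k)
    have "u (t + q * Suc k) = 10 powi g * u (t + q * k)"
      using assms(2)[of "t + q * k"] that by (simp add: algebra_simps)
    also have "\<dots> = 10 powi (g * int (Suc k)) * u (t + q * 0)"
      unfolding Suc by (simp add: distrib_left power_int_add)
    finally show ?case .
  qed simp
  then show ?thesis
    using assms(1) unfolding eventually_geometric_def geometric_def by blast
qed

lemma eventually_geometric_shift:
  assumes "eventually_geometric (\<lambda>k. u (k0 + k))"
  shows "eventually_geometric u"
proof -
  obtain k1 q where q: "q > 0" "\<And>t. t \<ge> k1 \<Longrightarrow> geometric (\<lambda>k. u (k0 + (t + q * k)))"
    using assms unfolding eventually_geometric_def by blast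
  have "geometric (\<lambda>k. u (t + q * k))" if "t \<ge> k0 + k1" for t
    using q(2)[of "t - k0"] that by (simp add: add.assoc [symmetric])
  then show ?thesis using q(1) unfolding eventually_geometric_def by blast
qed

text \<open>A common period \<open>Q\<close> of the \<open>q\<close> subsequences yields the period
  \<open>q * Q\<close> for \<open>u\<close>; the rates of different residues need not agree.\<close>

lemma eventually_geometric_residues:
  assumes "q > 0" and "\<And>s. s < q \<Longrightarrow> eventually_geometric (\<lambda>k. u (s + q * k))"
  shows "eventually_geometric u"
proof -
  obtain k1 Q where Q: "Q > 0"
    "\<And>s t. s < q \<Longrightarrow> t \<ge> k1 \<Longrightarrow> geometric (\<lambda>k. u (s + q * (t + Q * k)))"
    using eventually_geometric_common[of "{..<q}" "\<lambda>s k. u (s + q * k)"] assms(2)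
    by (auto simp del: lessThan_iff simp: Ball_def) (metis lessThan_iff)
  have "geometric (\<lambda>k. u (t + q * Q * k))" if "t \<ge> q * k1" for t
  proof -
    have "t div q \<ge> k1" using that assms(1) by (simp add: less_eq_div_iff_mult_less_eq mult.commute)
    then have "geometric (\<lambda>k. u (t mod q + q * (t div q + Q * k)))"
      using assms(1) by (intro Q(2)) auto
    moreover have "t mod q + q * (t div q + Q * k) = t + q * Q * k" for k
      by (simp add: distrib_left)
    ultimately show ?thesis by (simp only:)
  qed
  then show ?thesis
    using assms(1) Q(1) unfolding eventually_geometric_def
    by (intro exI[of _ "q * k1"] exI[of _ "q * Q"]) auto
qed

text \<open>Undoes a normalisation: over one period \<open>q\<close> the factor contributes the rate
  \<open>a * int q\<close>, which is subtracted again.\<close>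

lemma eventually_geometric_scale:
  assumes "eventually_geometric (\<lambda>k. 10 powi (a * int k) * u k)"
  shows "eventually_geometric u"
proof -
  obtain k0 q where q: "q > 0"
    "\<And>t. t \<ge> k0 \<Longrightarrow> geometric (\<lambda>k. 10 powi (a * int (t + q * k)) * u (t + q * k))"
    using assms unfolding eventually_geometric_def by blast
  have "geometric (\<lambda>k. u (t + q * k))" if t: "t \<ge> k0" for t
  proof -
    obtain g :: int where g: "\<And>k. 10 powi (a * int (t + q * k)) * u (t + q * k) =
        10 powi (g * int k) * (10 powi (a * int (t + q * 0)) * u (t + q * 0))"
      using q(2)[OF t] unfolding geometric_def by blast
    have "u (t + q * k) = 10 powi ((g - a * int q) * int k) * u (t + q * 0)" for k
    proof -
      have "(10::real) powi (g * int k) * 10 powi (a * int t) =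
          10 powi (a * int (t + q * k)) * 10 powi ((g - a * int q) * int k)"
        by (subst (1 2) power_int_add [symmetric]) (auto simp: algebra_simps)
      then have "10 powi (a * int (t + q * k)) * u (t + q * k) =
          10 powi (a * int (t + q * k)) * (10 powi ((g - a * int q) * int k) * u (t + q * 0))"
        using g[of k] by (simp add: mult.assoc [symmetric])
      then show ?thesis by simp
    qed
    then show ?thesis unfolding geometric_def by blast
  qed
  then show ?thesis using q(1) unfolding eventually_geometric_def by blast
qed

text \<open>A negative integral rate costs at least a factor 10 per step, so such entries sink below
  \<open>e\<close>, while those of rate 0 stay. The sign condition skips zero entries, whose rate is
  arbitrary.\<close>

lemma geometric_decay:
  fixes z :: "'n::finite \<Rightarrow> real" and g :: "'n \<Rightarrow> int"
  assumes "\<And>j. 0 \<le> z j" and "\<And>j. j \<in> A \<Longrightarrow> z j \<noteq> 0 \<Longrightarrow> g j \<le> 0" and "e > 0"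
  shows "\<exists>k0. \<forall>k\<ge>k0. \<forall>j\<in>A. 10 powi (g j * int k) * z j \<le> (if g j = 0 then z j else 0) + e"
proof -
  define U where "U = (\<Sum>j\<in>UNIV. z j) + 1"
  have U: "z j \<le> U" for j
  proof -
    have "z j \<le> (\<Sum>j\<in>UNIV. z j)" using assms(1) by (intro member_le_sum) auto
    then show ?thesis by (simp add: U_def)
  qed
  have "U > 0" unfolding U_def using sum_nonneg[of UNIV z] assms(1) by simp
  then obtain k0 where k0: "(1/10::real) ^ k0 < e / U"
    using real_arch_pow_inv[of "e / U" "1/10"] assms(3) by auto
  have "10 powi (g j * int k) * z j \<le> (if g j = 0 then z j else 0) + e" if "k \<ge> k0" "j \<in> A" for j k
  proof (cases "z j = 0 \<or> g j = 0")
    case True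
    then show ?thesis using assms(3) by auto
  next
    case False
    then have "g j \<le> -1" using assms(2) that by force
    then have "g j * int k \<le> - int k" by (metis mult_minus1 mult_right_mono of_nat_0_le_iff)
    then have "(10::real) powi (g j * int k) \<le> 10 powi (- int k)"
      by (intro power_int_increasing) auto
    also have "\<dots> = (1/10) ^ k" by (simp add: power_int_minus power_one_over inverse_eq_divide)
    also have "\<dots> \<le> (1/10) ^ k0" using that by (intro power_decreasing) auto
    finally have "10 powi (g j * int k) * z j \<le> (1/10) ^ k0 * U"
      using U assms(1) by (intro mult_mono) auto
    also have "\<dots> < e" using k0 \<open>U > 0\<close> by (simp add: field_simps)
    finally show ?thesis using False by simp
  qed
  then show ?thesis by blast
qed

section \<open>Orbits of rounded positive maps\<close>

definition zero_outside :: "'a set \<Rightarrow> ('a \<Rightarrow> real) \<Rightarrow> 'a \<Rightarrow> real" where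
  "zero_outside D v j = (if j \<in> D then v j else 0)"

text \<open>Values outside \<open>D\<close> are pinned to 0 so that, for positive \<open>a\<close>
  and finitely many indices, the set is finite.\<close>

definition float_box :: "nat \<Rightarrow> 'a set \<Rightarrow> real \<Rightarrow> real \<Rightarrow> ('a \<Rightarrow> real) set" where
  "float_box p D a b =
     {v. (\<forall>j\<in>D. v j \<in> float_numbers p \<and> a \<le> v j \<and> v j \<le> b) \<and> (\<forall>j. j \<notin> D \<longrightarrow> v j = 0)}"

lemma finite_float_box:
  fixes D :: "'a::finite set"
  assumes "a > 0"
  shows "finite (float_box p D a b)"
proof (rule finite_subset)
  show "float_box p D a b \<subseteq> {v. \<forall>j. (j \<in> D \<longrightarrow> v j \<in> {w \<in> float_numbers p. a \<le> w \<and> w \<le> b}) \<and>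
      (j \<notin> D \<longrightarrow> v j = 0)}"
    by (auto simp: float_box_def)
qed (intro finite_set_of_finite_funs finite_float_numbers_between assms finite)

text \<open>Dividing by the power of 10 just above \<open>v i0\<close> puts this component between
  1/10 and 1; the spread bound, used in both directions, confines the others.\<close>

lemma normalised_in_float_box:
  assumes i0: "i0 \<in> D" and v: "\<And>j. j \<in> D \<Longrightarrow> v j \<in> float_numbers p \<and> 0 < v j"
    and spread: "\<And>j j'. j \<in> D \<Longrightarrow> j' \<in> D \<Longrightarrow> v j \<le> \<kappa> * v j'"
  shows "(\<lambda>j. 10 powi (- dec_exponent (v i0)) * zero_outside D v j) \<in> float_box p D (1 / (10 * \<kappa>)) \<kappa>"
proof -
  let ?e = "dec_exponent (v i0)"
  let ?P = "(10::real) powi (- ?e)"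
  have pos: "v i0 > 0" using v i0 by blast
  have "0 < \<kappa> * v i0" using spread[OF i0 i0] pos by linarith
  then have \<kappa>: "\<kappa> > 0" using pos by (simp add: zero_less_mult_iff)
  have e: "10 powi (?e - 1) \<le> v i0" "v i0 < 10 powi ?e"
    using dec_exponent_bounds[of "v i0"] pos by auto
  have lo: "1/10 \<le> ?P * v i0"
    using e(1) by (simp add: power_int_diff power_int_minus field_simps)
  have hi: "?P * v i0 \<le> 1"
    using e(2) by (simp add: power_int_minus field_simps)
  have "1 / (10 * \<kappa>) \<le> ?P * v j \<and> ?P * v j \<le> \<kappa>" if j: "j \<in> D" for j
  proof
    have "?P * v i0 \<le> ?P * (\<kappa> * v j)" using spread[OF i0 j] by (intro mult_left_mono) auto
    also have "\<dots> = ?P * v j * \<kappa>" by simp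
    finally have "1/10 \<le> ?P * v j * \<kappa>" using lo by linarith
    then show "1 / (10 * \<kappa>) \<le> ?P * v j" using \<kappa> by (simp add: field_simps)
    have "?P * v j \<le> ?P * (\<kappa> * v i0)" using spread[OF j i0] by (intro mult_left_mono) auto
    also have "\<dots> = \<kappa> * (?P * v i0)" by simp
    also have "\<dots> \<le> \<kappa> * 1" using hi \<kappa> by (intro mult_left_mono) auto
    finally show "?P * v j \<le> \<kappa>" by simp
  qed
  then show ?thesis
    using v float_numbers_scale by (auto simp: float_box_def zero_outside_def)
qed

context rounded_map
begin

lemma uniform_lower: "\<exists>c>0. \<forall>v i j. (\<forall>k. 0 \<le> v k) \<longrightarrow> (j, i) \<in> E \<longrightarrow> c * v j \<le> f v i"
proof -
  let ?P = "\<lambda>(j, i) c. \<forall>v. (\<forall>k. 0 \<le> v k) \<longrightarrow> c * v j \<le> f v i"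
  have "\<exists>c>0. \<forall>x\<in>E. ?P x c"
  proof (rule uniform_positive_bound)
    show "\<exists>c>0. ?P x c" if "x \<in> E" for x
      using lower that by (cases x) auto
    show "?P x c'" if "?P x c" "0 < c'" "c' \<le> c" for x c c'
      using that by (cases x) (auto intro: order_trans[OF mult_right_mono])
  qed simp
  then show ?thesis by (simp add: case_prod_beta) (metis fst_conv snd_conv)
qed

lemma uniform_upper:
  "\<exists>C>0. \<forall>v B i. (\<forall>j. 0 \<le> v j) \<longrightarrow> (\<forall>j. (j, i) \<in> E \<longrightarrow> v j \<le> B) \<longrightarrow> 0 \<le> B \<longrightarrow> f v i \<le> C * B"
proof -
  obtain C where C: "\<And>i. C i > 0"
    "\<And>i v B. (\<forall>j. 0 \<le> v j) \<Longrightarrow> (\<forall>j. (j, i) \<in> E \<longrightarrow> v j \<le> B) \<Longrightarrow> 0 \<le> B \<Longrightarrow> f v i \<le> C i * B"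
    using upper by metis
  have le: "C i \<le> (\<Sum>i\<in>UNIV. C i)" for i
    using C(1) by (intro member_le_sum) (auto intro: less_imp_le)
  show ?thesis
  proof (intro exI[of _ "\<Sum>i\<in>UNIV. C i"] conjI allI impI)
    show "0 < (\<Sum>i\<in>UNIV. C i)" using C(1) by (intro sum_pos) auto
    fix v :: "'n \<Rightarrow> real" and B i
    assume v: "\<forall>j. 0 \<le> v j" "\<forall>j. (j, i) \<in> E \<longrightarrow> v j \<le> B" "0 \<le> B"
    have "f v i \<le> C i * B" using v by (rule C(2))
    also have "\<dots> \<le> (\<Sum>i\<in>UNIV. C i) * B" using le v by (intro mult_right_mono) auto
    finally show "f v i \<le> (\<Sum>i\<in>UNIV. C i) * B" .
  qed
qed

lemma uniform_right:
  assumes "finite V" and "\<And>v j. v \<in> V \<Longrightarrow> 0 \<le> v j" and "\<And>v i. v \<in> V \<Longrightarrow> i \<in> D \<Longrightarrow> 0 < f v i"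
  shows "\<exists>e>0. \<forall>v\<in>V. \<forall>i\<in>D. \<forall>u. (\<forall>j. v j \<le> u j \<and> u j \<le> v j + e) \<longrightarrow> f u i = f v i"
proof -
  let ?P = "\<lambda>(v, i) e. \<forall>u. (\<forall>j. v j \<le> u j \<and> u j \<le> v j + e) \<longrightarrow> f u i = f v i"
  have "\<exists>e>0. \<forall>x\<in>V\<times>D. ?P x e"
  proof (rule uniform_positive_bound)
    show "finite (V \<times> D)" using assms(1) by simp
    show "\<exists>e>0. ?P x e" if "x \<in> V \<times> D" for x
      using right[of "fst x" "snd x"] assms(2,3) that by (cases x) auto
    show "?P x e'" if "?P x e" "0 < e'" "e' \<le> e" for x e e'
    proof (cases x)
      case (Pair v i)
      have "f u i = f v i" if u: "\<forall>j. v j \<le> u j \<and> u j \<le> v j + e'" for u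
      proof -
        have "v j \<le> u j \<and> u j \<le> v j + e" for j
          using u[rule_format, of j] \<open>e' \<le> e\<close> by linarith
        then show ?thesis using \<open>?P x e\<close> Pair by simp
      qed
      then show ?thesis using Pair by simp
    qed
  qed
  then show ?thesis by auto
qed

text \<open>The spread bound leaves finitely many states of \<open>D\<close> up to a power of 10, so
  two of them are proportional; since the step commutes with powers of 10, the proportion persists
  forever.\<close>

lemma autonomous_eventually_geometric:
  assumes i0: "i0 \<in> D"
    and fl: "\<And>k j. k \<ge> k1 \<Longrightarrow> j \<in> D \<Longrightarrow> y k j \<in> float_numbers p \<and> 0 < y k j"
    and spread: "\<And>k j j'. k \<ge> k1 \<Longrightarrow> j \<in> D \<Longrightarrow> j' \<in> D \<Longrightarrow> y k j \<le> \<kappa> * y k j'"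
    and step: "\<And>k i. k \<ge> k1 \<Longrightarrow> i \<in> D \<Longrightarrow> y (Suc k) i = f (zero_outside D (y k)) i"
    and i: "i \<in> D"
  shows "eventually_geometric (\<lambda>k. y k i)"
proof -
  define e where "e k = dec_exponent (y k i0)" for k
  define N where "N k = (\<lambda>j. 10 powi (- e k) * zero_outside D (y k) j)" for k
  have pos: "0 < y k1 i0" "y k1 i0 \<le> \<kappa> * y k1 i0" using fl spread i0 by auto
  then have "0 < \<kappa> * y k1 i0" by linarith
  then have \<kappa>: "\<kappa> > 0" using pos by (simp add: zero_less_mult_iff)
  have "N ` {k1..} \<subseteq> float_box p D (1 / (10 * \<kappa>)) \<kappa>"
    unfolding N_def e_def using normalised_in_float_box[OF i0 fl spread] by auto
  then have "finite (N ` {k1..})"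
    by (rule finite_subset) (intro finite_float_box, use \<kappa> in simp)
  then have "\<not> inj_on N {k1..}" using finite_imageD infinite_Ici by blast
  then obtain k k' where k: "k1 \<le> k" "k < k'" "N k = N k'"
    unfolding inj_on_def by (metis atLeast_iff linorder_neqE_nat)
  define \<gamma> where "\<gamma> = e k' - e k"
  have "y (k' + m) j = 10 powi \<gamma> * y (k + m) j" if "j \<in> D" for m j
    using that
  proof (induction m arbitrary: j)
    case 0
    have "10 powi (- e k) * y k j = 10 powi (- e k') * y k' j"
      using fun_cong[OF k(3), of j] 0 by (simp add: N_def zero_outside_def)
    then have "10 powi e k' * (10 powi (- e k) * y k j) = 10 powi e k' * (10 powi (- e k') * y k' j)"
      by simp
    then show ?case by (simp add: \<gamma>_def power_int_diff power_int_minus field_simps)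
  next
    case (Suc m)
    have eq: "zero_outside D (y (k' + m)) = (\<lambda>j. 10 powi \<gamma> * zero_outside D (y (k + m)) j)"
      using Suc.IH by (auto simp: zero_outside_def)
    have "y (k' + Suc m) j = f (zero_outside D (y (k' + m))) j"
      using step[of "k' + m" j] k Suc.prems by simp
    also have "\<dots> = 10 powi \<gamma> * f (zero_outside D (y (k + m))) j"
      unfolding eq by (rule scale)
    also have "\<dots> = 10 powi \<gamma> * y (k + Suc m) j"
      using step[of "k + m" j] k Suc.prems by simp
    finally show ?case .
  qed
  from this[OF i] have *: "y (k' + m) i = 10 powi \<gamma> * y (k + m) i" for m .
  show ?thesis
  proof (rule eventually_geometric_recurrence)
    show "k' - k > 0" using k by simp
    show "y (n + (k' - k)) i = 10 powi \<gamma> * y n i" if "n \<ge> k" for n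
      using *[of "n - k"] that k by (simp add: add.commute)
  qed
qed

text \<open>Here the fastest growing input to the clique \<open>D\<close> is constant. If \<open>D\<close> stays far above its
  inputs, these never cause a carry and can be ignored; otherwise \<open>D\<close> returns infinitely often to
  one of finitely many states.\<close>

lemma clique_constant_inputs:
  assumes i0: "i0 \<in> D"
    and preds: "\<And>i j. i \<in> D \<Longrightarrow> (j, i) \<in> E \<longleftrightarrow> j \<in> D \<or> j \<in> A"
    and disj: "D \<inter> A = {}"
    and y: "\<And>k i. y (Suc k) i = f (y k) i"
    and nn: "\<And>k j. 0 \<le> y k j"
    and fl: "\<And>k j. j \<in> D \<Longrightarrow> y k j \<in> float_numbers p \<and> 0 < y k j"
    and g: "\<And>k j. j \<in> A \<Longrightarrow> y k j = 10 powi (g j * int k) * y 0 j"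
    and g_le: "\<And>j. j \<in> A \<Longrightarrow> y 0 j \<noteq> 0 \<Longrightarrow> g j \<le> 0"
    and z: "z \<in> A" "0 < y 0 z" "g z = 0"
    and i: "i \<in> D"
  shows "eventually_geometric (\<lambda>k. y k i)"
proof -
  obtain c where c: "c > 0" "\<And>v i j. (\<forall>k. 0 \<le> v k) \<Longrightarrow> (j, i) \<in> E \<Longrightarrow> c * v j \<le> f v i"
    using uniform_lower by blast
  obtain C where C: "C > 0"
    "\<And>v B i. (\<forall>j. 0 \<le> v j) \<Longrightarrow> (\<forall>j. (j, i) \<in> E \<longrightarrow> v j \<le> B) \<Longrightarrow> 0 \<le> B \<Longrightarrow> f v i \<le> C * B"
    using uniform_upper by blast
  \<comment> \<open>If the maximum \<open>B\<close> over \<open>D\<close> dominates the inputs, all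
    next values in \<open>D\<close> lie between \<open>c * B\<close> and \<open>C * B\<close>, hence
    within the factor \<open>C / c\<close> of each other.\<close>
  define \<kappa> where "\<kappa> = C / c"
  have \<kappa>: "\<kappa> > 0" using c C by (simp add: \<kappa>_def)
  \<comment> \<open>Bounds every input at all times, since non-zero inputs do not grow.\<close>
  define U where "U = (\<Sum>j\<in>UNIV. y 0 j) + 1"
  have U0: "y 0 j < U" for j
  proof -
    have "y 0 j \<le> (\<Sum>j\<in>UNIV. y 0 j)" using nn by (intro member_le_sum) auto
    then show ?thesis by (simp add: U_def)
  qed
  have U: "y k j \<le> U" if j: "j \<in> A" for k j
  proof (cases "y 0 j = 0")
    case False
    have "(10::real) powi (g j * int k) \<le> 10 powi 0"
      using g_le[OF j False] by (intro power_int_increasing) (auto simp: mult_le_0_iff)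
    then have "10 powi (g j * int k) * y 0 j \<le> 1 * y 0 j"
      using nn by (intro mult_right_mono) auto
    then show ?thesis using g[OF j, of k] U0[of j] by simp
  qed (use g[OF j, of k] U0[of j] in simp)
  have "U > 0" using U0[of z] z by linarith
  \<comment> \<open>Every member of \<open>D\<close> feeds all of \<open>D\<close>, so the maximum
    \<open>B\<close> reaches all members in one step. The first alternative is the case
    \<open>B \<le> U\<close>, the second the case where \<open>D\<close> dominates.\<close>
  have spread: "(\<forall>j\<in>D. y (Suc k) j \<le> C * U) \<or> (\<forall>j\<in>D. \<forall>j'\<in>D. y (Suc k) j \<le> \<kappa> * y (Suc k) j')" for k
  proof -
    define B where "B = Max (y k ` D)"
    have B: "y k j \<le> B" if "j \<in> D" for j unfolding B_def using that by (intro Max_ge) auto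
    have "B \<in> y k ` D" unfolding B_def using i0 by (intro Max_in) auto
    then obtain b where b: "b \<in> D" "B = y k b" by blast
    have up: "y (Suc k) j \<le> C * max B U" if "j \<in> D" for j
      unfolding y using nn B U preds[OF that] \<open>U > 0\<close>
      by (intro C(2)) (auto simp: le_max_iff_disj)
    have lo: "c * B \<le> y (Suc k) j" if "j \<in> D" for j
      unfolding y b(2) using nn preds[OF that] b(1) by (intro c(2)) auto
    show ?thesis
    proof (cases "B \<le> U")
      case True
      then show ?thesis using up by (simp add: max_absorb2)
    next
      case False
      have "y (Suc k) j \<le> \<kappa> * y (Suc k) j'" if "j \<in> D" "j' \<in> D" for j j'
      proof -
        have "y (Suc k) j \<le> C * B" using up[OF that(1)] False by (simp add: max_absorb1)
        also have "\<dots> = \<kappa> * (c * B)" using c by (simp add: \<kappa>_def)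
        also have "\<dots> \<le> \<kappa> * y (Suc k) j'" using lo[OF that(2)] \<kappa> by (intro mult_left_mono) auto
        finally show ?thesis .
      qed
      then show ?thesis by blast
    qed
  qed
  let ?V = "float_box p D (1 / (10 * \<kappa>)) \<kappa>"
  have V_nn: "0 \<le> v j" if "v \<in> ?V" for v j
  proof (cases "j \<in> D")
    case True
    then have "1 / (10 * \<kappa>) \<le> v j" using that by (simp add: float_box_def)
    moreover have "0 < 1 / (10 * \<kappa>)" using \<kappa> by simp
    ultimately show ?thesis by linarith
  qed (use that in \<open>simp add: float_box_def\<close>)
  have V_pos: "0 < f v i" if v: "v \<in> ?V" and "i \<in> D" for v i
  proof -
    have "0 < 1 / (10 * \<kappa>)" using \<kappa> by simp
    also have "\<dots> \<le> v i0" using v i0 by (simp add: float_box_def)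
    finally have "0 < c * v i0" using c by simp
    also have "\<dots> \<le> f v i" using V_nn[OF v] preds[OF \<open>i \<in> D\<close>] i0 by (intro c(2)) auto
    finally show ?thesis .
  qed
  have "finite ?V" using \<kappa> by (intro finite_float_box) simp
  then obtain e1 where e1: "e1 > 0"
    "\<And>v i u. v \<in> ?V \<Longrightarrow> i \<in> D \<Longrightarrow> (\<forall>j. v j \<le> u j \<and> u j \<le> v j + e1) \<Longrightarrow> f u i = f v i"
    using uniform_right[of ?V D] V_nn V_pos by blast
  \<comment> \<open>Above \<open>C * U\<close> the second alternative of \<open>spread\<close> must
    hold; above \<open>U / e1\<close> the inputs are at most the tolerance \<open>e1\<close> after
    normalisation by the size of \<open>D\<close>.\<close>
  define K where "K = max (C * U) (U / e1)"
  \<comment> \<open>Stated for an arbitrary \<open>u\<close>, because it is applied both to the true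
    state \<open>y k\<close> and to the idealised state \<open>s k\<close> below.\<close>
  have high: "f u i = f (zero_outside D (y k)) i"
    if k: "y k i0 > K" "k \<ge> 1" and u: "\<And>j. j \<in> D \<Longrightarrow> u j = y k j" "\<And>j. j \<in> A \<Longrightarrow> 0 \<le> u j \<and> u j \<le> U"
      and i: "i \<in> D" for k u i
  proof -
    obtain k0 where "k = Suc k0" using k(2) by (cases k) auto
    moreover have "\<not> y k i0 \<le> C * U" using k(1) by (simp add: K_def)
    ultimately have sp: "\<forall>j\<in>D. \<forall>j'\<in>D. y k j \<le> \<kappa> * y k j'" using spread[of k0] i0 by blast
    define e where "e = dec_exponent (y k i0)"
    define v where "v = (\<lambda>j. 10 powi (- e) * zero_outside D (y k) j)"
    \<comment> \<open>The tolerance concerns all coordinates, so those outside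
      \<open>D \<union> A\<close> are set to 0; by \<open>cong\<close> component \<open>i\<close> of
      \<open>f\<close> does not see them.\<close>
    define u' where "u' = (\<lambda>j. if j \<in> D \<union> A then 10 powi (- e) * u j else 0)"
    have v: "v \<in> ?V" unfolding v_def e_def using sp fl by (intro normalised_in_float_box i0) auto
    have "y k i0 < 10 powi e"
      using dec_exponent_bounds(2)[of "y k i0"] fl[OF i0, of k] by (simp add: e_def)
    then have "U / e1 < 10 powi e" using k(1) by (simp add: K_def)
    then have U_e: "10 powi (- e) * U \<le> e1"
      using e1(1) by (simp add: power_int_minus field_simps)
    have "v j \<le> u' j \<and> u' j \<le> v j + e1" for j
    proof (cases "j \<in> A")
      case True
      then have j: "j \<notin> D" using disj by blast
      have "10 powi (- e) * u j \<le> 10 powi (- e) * U" using u(2)[OF True] by (intro mult_left_mono) auto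
      then have "10 powi (- e) * u j \<le> e1" using U_e by linarith
      then show ?thesis using True j u(2)[OF True] by (simp add: v_def u'_def zero_outside_def)
    qed (use u(1) e1(1) in \<open>auto simp: v_def u'_def zero_outside_def\<close>)
    then have "f u' i = f v i" using e1(2)[OF v i] by blast
    moreover have "f u' i = f (\<lambda>j. 10 powi (- e) * u j) i"
      using preds[OF i] by (intro cong) (auto simp: u'_def)
    ultimately have "10 powi (- e) * f u i = 10 powi (- e) * f (zero_outside D (y k)) i"
      unfolding v_def by (simp only: scale)
    then show ?thesis by simp
  qed
  have high_y: "y (Suc k) i = f (zero_outside D (y k)) i" if "y k i0 > K" "k \<ge> 1" "i \<in> D" for k i
    unfolding y using that U nn by (intro high) auto
  show ?thesis
  proof (cases "\<exists>k1. \<forall>k\<ge>k1. y k i0 > K")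
    case True
    then obtain k1 where k1: "\<And>k. k \<ge> k1 \<Longrightarrow> y k i0 > K" by blast
    show ?thesis
    proof (rule autonomous_eventually_geometric[OF i0 fl _ _ i])
      fix k j j' assume k: "max k1 1 \<le> k" and j: "j \<in> D" "j' \<in> D"
      obtain k0 where k0: "k = Suc k0" using k by (cases k) auto
      have "\<not> y k i0 \<le> C * U" using k1[of k] k by (simp add: K_def)
      then show "y k j \<le> \<kappa> * y k j'" using spread[of k0] i0 j unfolding k0 by blast
    next
      fix k i assume "max k1 1 \<le> k" "i \<in> D"
      then show "y (Suc k) i = f (zero_outside D (y k)) i" using k1[of k] by (intro high_y) auto
    qed
  next
    case False
    \<comment> \<open>\<open>w\<close> keeps only the constant inputs, and \<open>s k\<close> joins
      them to the true state of \<open>D\<close>. From time 1 on the input \<open>z\<close> bounds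
      \<open>D\<close> below by \<open>l\<close>, and \<open>spread\<close> bounds it above by
      \<open>L\<close> whenever \<open>y k i0\<close> is at most \<open>K\<close>.\<close>
    define w where "w = (\<lambda>j. if j \<in> A \<and> g j = 0 then y 0 j else 0)"
    define s where "s k = (\<lambda>j. zero_outside D (y k) j + w j)" for k
    define l where "l = c * y 0 z"
    define L where "L = max (C * U) (\<kappa> * K)"
    have w: "0 \<le> w j" for j using nn by (simp add: w_def)
    have l: "l > 0" using c z by (simp add: l_def)
    have yl: "l \<le> y (Suc k) j" if "j \<in> D" for k j
    proof -
      have "y k z = y 0 z" using g[OF z(1), of k] z by simp
      moreover have "c * y k z \<le> f (y k) j" using nn preds[OF that] z by (intro c(2)) auto
      ultimately show ?thesis by (simp add: l_def y)
    qed
    define W where "W = (\<lambda>v j. v j + w j) ` float_box p D l L"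
    have "finite W" unfolding W_def by (intro finite_imageI finite_float_box l)
    have low: "s k \<in> W" if k: "k \<ge> 1" "y k i0 \<le> K" for k
    proof -
      obtain k0 where k0: "k = Suc k0" using k(1) by (cases k) auto
      have "y k j \<le> L" if j: "j \<in> D" for j
        using spread[of k0]
      proof
        assume "\<forall>j\<in>D. y (Suc k0) j \<le> C * U"
        then show ?thesis using j by (auto simp: k0 L_def)
      next
        assume "\<forall>j\<in>D. \<forall>j'\<in>D. y (Suc k0) j \<le> \<kappa> * y (Suc k0) j'"
        then have "y k j \<le> \<kappa> * y k i0" using i0 j by (simp add: k0)
        also have "\<dots> \<le> \<kappa> * K" using k(2) \<kappa> by (intro mult_left_mono) auto
        finally show ?thesis by (simp add: L_def)
      qed
      then have "zero_outside D (y k) \<in> float_box p D l L"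
        using fl yl[of _ k0] by (auto simp: float_box_def zero_outside_def k0)
      then show ?thesis unfolding s_def W_def by blast
    qed
    have W_nn: "0 \<le> v j" if v: "v \<in> W" for v j
    proof -
      obtain v' where v': "v' \<in> float_box p D l L" "v = (\<lambda>j. v' j + w j)" using v unfolding W_def by blast
      have "0 \<le> v' j" using v'(1) l by (cases "j \<in> D") (force simp: float_box_def)+
      then show ?thesis using v'(2) w by simp
    qed
    have W_pos: "0 < f v i" if v: "v \<in> W" and "i \<in> D" for v i
    proof -
      obtain v' where v': "v' \<in> float_box p D l L" "v = (\<lambda>j. v' j + w j)" using v unfolding W_def by blast
      have "l \<le> v' i0" using v'(1) i0 by (simp add: float_box_def)
      then have "0 < v i0" using l v'(2) w[of i0] by simp
      then have "0 < c * v i0" using c by simp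
      also have "\<dots> \<le> f v i" using W_nn[OF v] preds[OF \<open>i \<in> D\<close>] i0 by (intro c(2)) auto
      finally show ?thesis .
    qed
    obtain e2 where e2: "e2 > 0"
      "\<And>v i u. v \<in> W \<Longrightarrow> i \<in> D \<Longrightarrow> (\<forall>j. v j \<le> u j \<and> u j \<le> v j + e2) \<Longrightarrow> f u i = f v i"
      using uniform_right[OF \<open>finite W\<close>, of D] W_nn W_pos by blast
    obtain k2 where k2: "\<And>k j. k \<ge> k2 \<Longrightarrow> j \<in> A \<Longrightarrow>
        10 powi (g j * int k) * y 0 j \<le> (if g j = 0 then y 0 j else 0) + e2"
      using geometric_decay[of "y 0" A g e2] nn g_le e2(1) by blast
    \<comment> \<open>From here on the next state of \<open>D\<close> depends on \<open>s k\<close>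
      alone: above \<open>K\<close> inputs have no effect at all, and otherwise the decaying inputs
      lie within the tolerance \<open>e2\<close>.\<close>
    have s_step: "y (Suc k) i = f (s k) i" if k: "k \<ge> max k2 1" and i: "i \<in> D" for k i
    proof (cases "y k i0 > K")
      case True
      have "f (s k) i = f (zero_outside D (y k)) i"
      proof (rule high[OF True _ _ _ i])
        show "k \<ge> 1" using k by simp
        show "s k j = y k j" if "j \<in> D" for j
          using that disj by (auto simp: s_def w_def zero_outside_def)
        show "0 \<le> s k j \<and> s k j \<le> U" if "j \<in> A" for j
          using that disj nn U0[of j] \<open>U > 0\<close> by (auto simp: s_def w_def zero_outside_def)
      qed
      then show ?thesis using high_y[OF True _ i] k by simp
    next
      case False
      define u where "u = (\<lambda>j. if j \<in> D \<union> A then y k j else 0)"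
      have sW: "s k \<in> W" using low k False by simp
      have "s k j \<le> u j \<and> u j \<le> s k j + e2" for j
      proof (cases "j \<in> A")
        case True
        then show ?thesis
          using g[OF True, of k] k2[of k j] k disj nn[of k j]
          by (auto simp: s_def w_def u_def zero_outside_def)
      qed (use e2(1) in \<open>auto simp: s_def w_def u_def zero_outside_def\<close>)
      then have "f u i = f (s k) i" using e2(2)[OF sW i] by blast
      moreover have "f u i = f (y k) i"
        using preds[OF i] by (intro cong) (auto simp: u_def)
      ultimately show ?thesis by (simp add: y)
    qed
    \<comment> \<open>At these infinitely many times \<open>s\<close> takes values in the finite set
      \<open>W\<close>, so some \<open>s k\<close> recurs exactly. By \<open>s_step\<close> the
      recurrence persists, also at times when \<open>i0\<close> exceeds \<open>K\<close>.\<close>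
    define T where "T = {k. k \<ge> max k2 1 \<and> y k i0 \<le> K}"
    have "infinite T"
      unfolding infinite_nat_iff_unbounded_le
    proof
      fix m
      obtain k where "k \<ge> max m (max k2 1)" "y k i0 \<le> K" using False by (meson not_le)
      then show "\<exists>n\<ge>m. n \<in> T" by (auto simp: T_def)
    qed
    moreover have "s ` T \<subseteq> W" using low by (auto simp: T_def)
    then have "finite (s ` T)" using \<open>finite W\<close> by (rule finite_subset)
    ultimately have "\<not> inj_on s T" using finite_imageD by blast
    then obtain k k' where k: "k \<in> T" "k < k'" "s k = s k'"
      unfolding inj_on_def by (metis linorder_neqE_nat)
    have kk: "k \<ge> max k2 1" using k(1) by (simp add: T_def)
    have "s (k' + m) = s (k + m)" for m
    proof (induction m)
      case (Suc m)
      have "y (Suc (k' + m)) j = y (Suc (k + m)) j" if "j \<in> D" for j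
        using s_step[of "k' + m" j] s_step[of "k + m" j] k(2) kk that Suc by simp
      then show ?case by (auto simp: s_def zero_outside_def)
    qed (use k(3) in simp)
    moreover have "w i = 0" using i disj by (auto simp: w_def)
    moreover have "s n i = y n i + w i" for n using i by (simp add: s_def zero_outside_def)
    ultimately have *: "y (k' + m) i = y (k + m) i" for m by (metis add_0_right)
    show ?thesis
    proof (rule eventually_geometric_recurrence)
      show "k' - k > 0" using k by simp
      show "y (n + (k' - k)) i = 10 powi 0 * y n i" if "n \<ge> k" for n
        using *[of "n - k"] that k by (simp add: add.commute)
    qed
  qed
qed

text \<open>With \<open>G\<close> the largest rate of a non-zero input, multiplying the state at
  time \<open>k\<close> by \<open>10 powi (- G * int k)\<close> makes the fastest input constant and
  lets no other grow. Without non-zero inputs, \<open>D\<close> is autonomous.\<close>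

lemma clique_geometric_inputs:
  assumes i0: "i0 \<in> D"
    and preds: "\<And>i j. i \<in> D \<Longrightarrow> (j, i) \<in> E \<longleftrightarrow> j \<in> D \<or> j \<in> A"
    and disj: "D \<inter> A = {}"
    and y: "\<And>k i. y (Suc k) i = f (y k) i"
    and nn: "\<And>k j. 0 \<le> y k j"
    and fl: "\<And>k j. j \<in> D \<Longrightarrow> y k j \<in> float_numbers p \<and> 0 < y k j"
    and g: "\<And>k j. j \<in> A \<Longrightarrow> y k j = 10 powi (g j * int k) * y 0 j"
    and i: "i \<in> D"
  shows "eventually_geometric (\<lambda>k. y k i)"
proof (cases "\<forall>j\<in>A. y 0 j = 0")
  case True
  then have y0: "y k j = 0" if "j \<in> A" for j k using g[OF that, of k] that by simp
  obtain c where c: "c > 0" "\<And>v i j. (\<forall>k. 0 \<le> v k) \<Longrightarrow> (j, i) \<in> E \<Longrightarrow> c * v j \<le> f v i"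
    using uniform_lower by blast
  obtain C where C: "C > 0"
    "\<And>v B i. (\<forall>j. 0 \<le> v j) \<Longrightarrow> (\<forall>j. (j, i) \<in> E \<longrightarrow> v j \<le> B) \<Longrightarrow> 0 \<le> B \<Longrightarrow> f v i \<le> C * B"
    using uniform_upper by blast
  show ?thesis
  \<comment> \<open>The spread bound needs one step of mixing inside \<open>D\<close>, hence the
    start at 1.\<close>
  proof (rule autonomous_eventually_geometric[OF i0 fl _ _ i, where \<kappa> = "C / c" and ?k1.0 = 1])
    fix k :: nat and j j' assume k: "1 \<le> k" and j: "j \<in> D" "j' \<in> D"
    obtain k0 where k0: "k = Suc k0" using k by (cases k) auto
    define B where "B = Max (y k0 ` D)"
    have B: "y k0 j \<le> B" if "j \<in> D" for j unfolding B_def using that by (intro Max_ge) auto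
    have "B \<in> y k0 ` D" unfolding B_def using i0 by (intro Max_in) auto
    then obtain b where b: "b \<in> D" "B = y k0 b" by blast
    have "B \<ge> 0" using b nn by simp
    then have "y k j \<le> C * B"
      unfolding k0 y using nn B y0 preds[OF j(1)] by (intro C(2)) auto
    also have "\<dots> = C / c * (c * B)" using c by simp
    also have "\<dots> \<le> C / c * y k j'"
      unfolding k0 y b(2) using nn preds[OF j(2)] b(1) c C by (intro mult_left_mono c(2)) auto
    finally show "y k j \<le> C / c * y k j'" .
  next
    fix k i assume "i \<in> D"
    then show "y (Suc k) i = f (zero_outside D (y k)) i"
      unfolding y using preds y0 disj by (intro cong) (auto simp: zero_outside_def)
  qed
next
  case False
  \<comment> \<open>Vanishing inputs are left out, since their rates \<open>g j\<close> carry no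
    information.\<close>
  define Z where "Z = {j \<in> A. y 0 j \<noteq> 0}"
  have Z: "finite Z" "Z \<noteq> {}" using False by (auto simp: Z_def)
  define G where "G = Max (g ` Z)"
  have "G \<in> g ` Z" unfolding G_def using Z by (intro Max_in) auto
  then obtain z where z: "z \<in> Z" "g z = G" by blast
  have G: "g j \<le> G" if "j \<in> Z" for j unfolding G_def using that Z by (intro Max_ge) auto
  interpret h: rounded_map p E "\<lambda>v i. 10 powi (- G) * f v i"
    by (rule rounded_map_scale) (rule rounded_map_axioms)
  define w where "w k = (\<lambda>j. 10 powi (- G * int k) * y k j)" for k
  have "eventually_geometric (\<lambda>k. w k i)"
  proof (rule h.clique_constant_inputs[OF i0 preds disj _ _ _ _ _ _ _ _ i])
    show "w (Suc k) i = 10 powi (- G) * f (w k) i" for k i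
    proof -
      have "(10::real) powi (- G * int (Suc k)) = 10 powi (- G) * 10 powi (- G * int k)"
        by (subst power_int_add [symmetric]) (auto simp: algebra_simps)
      then show ?thesis by (simp only: w_def scale y mult.assoc)
    qed
    show "0 \<le> w k j" for k j using nn by (simp add: w_def)
    show "w k j \<in> float_numbers p \<and> 0 < w k j" if "j \<in> D" for k j
      using fl[OF that, of k] by (auto simp: w_def float_numbers_scale)
    show "w k j = 10 powi ((g j - G) * int k) * w 0 j" if "j \<in> A" for k j
    proof -
      have "(10::real) powi ((g j - G) * int k) = 10 powi (- G * int k) * 10 powi (g j * int k)"
        by (subst power_int_add [symmetric]) (auto simp: algebra_simps)
      then show ?thesis using g[OF that, of k] by (simp add: w_def)
    qed
    show "g j - G \<le> 0" if "j \<in> A" "w 0 j \<noteq> 0" for j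
      using G[of j] that by (simp add: Z_def w_def)
    show "z \<in> A" "0 < w 0 z" "g z - G = 0"
      using z nn[of 0 z] by (auto simp: Z_def w_def)
  qed
  then show ?thesis unfolding w_def by (rule eventually_geometric_scale)
qed

text \<open>Relative to the largest rate \<open>G\<close>, slower inputs decay below the tolerance
  of \<open>f\<close>, so the fastest ones alone determine the value. This serves components that do
  not feed themselves.\<close>

lemma geometric_inputs:
  assumes y: "\<And>k. y (Suc k) i = f (y k) i"
    and nn: "\<And>k j. 0 \<le> y k j"
    and g: "\<And>k j. (j, i) \<in> E \<Longrightarrow> y k j = 10 powi (g j * int k) * y 0 j"
  shows "eventually_geometric (\<lambda>k. y k i)"
proof -
  define A where "A = {j. (j, i) \<in> E}"
  have g: "y k j = 10 powi (g j * int k) * y 0 j" if "j \<in> A" for k j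
    using that unfolding A_def by (intro g) simp
  obtain c where c: "c > 0" "\<And>v i j. (\<forall>k. 0 \<le> v k) \<Longrightarrow> (j, i) \<in> E \<Longrightarrow> c * v j \<le> f v i"
    using uniform_lower by blast
  show ?thesis
  proof (cases "\<forall>j\<in>A. y 0 j = 0")
    case True
    then have y0: "y k j = 0" if "j \<in> A" for j k using g[OF that, of k] that by simp
    have "y (Suc k) i = f (y 0) i" for k
      unfolding y using y0 by (intro cong) (auto simp: A_def)
    then show ?thesis
      by (intro eventually_geometric_recurrence[of 1 1 _ 0]) (auto simp: Suc_le_eq gr0_conv_Suc)
  next
    case False
    define Z where "Z = {j \<in> A. y 0 j \<noteq> 0}"
    have Z: "finite Z" "Z \<noteq> {}" using False by (auto simp: Z_def)
    define G where "G = Max (g ` Z)"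
    have "G \<in> g ` Z" unfolding G_def using Z by (intro Max_in) auto
    then obtain z where z: "z \<in> Z" "g z = G" by blast
    have G: "g j \<le> G" if "j \<in> Z" for j unfolding G_def using that Z by (intro Max_ge) auto
    \<comment> \<open>The fastest inputs alone, at their initial values; \<open>z\<close> is one of
      them, so \<open>f s i\<close> is positive and \<open>right\<close> applies.\<close>
    define s where "s = (\<lambda>j. if j \<in> A \<and> g j = G then y 0 j else 0)"
    have s: "0 \<le> s j" for j using nn by (simp add: s_def)
    have "0 < s z" using z nn[of 0 z] by (simp add: s_def Z_def)
    then have "0 < c * s z" using c by simp
    also have "\<dots> \<le> f s i" using s z by (intro c(2)) (auto simp: Z_def A_def)
    finally obtain e where e: "e > 0" "\<And>u. (\<forall>j. s j \<le> u j \<and> u j \<le> s j + e) \<Longrightarrow> f u i = f s i"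
      using right[of s i] s by blast
    have "g j - G \<le> 0" if "j \<in> A" "y 0 j \<noteq> 0" for j
      using G[of j] that by (simp add: Z_def)
    then obtain k0 where k0: "\<And>k j. k \<ge> k0 \<Longrightarrow> j \<in> A \<Longrightarrow>
        10 powi ((g j - G) * int k) * y 0 j \<le> (if g j - G = 0 then y 0 j else 0) + e"
      using geometric_decay[of "y 0" A "\<lambda>j. g j - G" e] nn e(1) by blast
    have step: "y (Suc k) i = 10 powi (G * int k) * f s i" if k: "k \<ge> k0" for k
    proof -
      define u where "u = (\<lambda>j. if j \<in> A then 10 powi ((g j - G) * int k) * y 0 j else 0)"
      have "s j \<le> u j \<and> u j \<le> s j + e" for j
        using k0[OF k, of j] nn e(1) by (auto simp: u_def s_def)
      then have u: "f u i = f s i" by (intro e(2)) blast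
      have "f (y k) i = f (\<lambda>j. 10 powi (G * int k) * u j) i"
      proof (rule cong)
        fix j assume "(j, i) \<in> E"
        then have j: "j \<in> A" by (simp add: A_def)
        have "(10::real) powi (g j * int k) = 10 powi (G * int k) * 10 powi ((g j - G) * int k)"
          by (subst power_int_add [symmetric]) (auto simp: algebra_simps)
        then show "y k j = 10 powi (G * int k) * u j" using g[OF j, of k] j by (simp add: u_def)
      qed
      then show ?thesis using scale u by (simp add: y)
    qed
    show ?thesis
    proof (rule eventually_geometric_recurrence)
      show "(1::nat) > 0" by simp
      show "y (k + 1) i = 10 powi G * y k i" if k: "k \<ge> Suc k0" for k
      proof -
        obtain m where m: "k = Suc m" "m \<ge> k0" using k by (cases k) auto
        show ?thesis
          using step[of m] step[of "Suc m"] m by (simp add: power_int_add distrib_left)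
      qed
    qed
  qed
qed

text \<open>Idempotence makes \<open>E\<close> transitive, so a strict predecessor of
  \<open>i\<close> has fewer predecessors than \<open>i\<close> and is geometric by induction. What
  remains is \<open>i\<close> alone or the clique around it, fed by geometric inputs.\<close>

theorem orbit_eventually_geometric:
  assumes idem: "E O E = E"
    and y: "\<And>k. y (Suc k) = f (y k)" and y0: "\<And>j. 0 \<le> y 0 j"
  shows "eventually_geometric (\<lambda>k. y k i)"
\<comment> \<open>Counting \<open>i\<close> itself makes the decrease strict even when
  \<open>i\<close> does not feed itself: \<open>i\<close> is never counted for a strict
  predecessor.\<close>
proof (induction "card {j. (j, i) \<in> E \<or> j = i}" arbitrary: i rule: less_induct)
  case less
  have E_trans: "(a, c) \<in> E" if "(a, b) \<in> E" "(b, c) \<in> E" for a b c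
    using that idem by blast
  have nn: "0 \<le> y k j" for k j
    by (induction k arbitrary: j) (auto simp: y y0 intro: nonneg)
  have iter: "y (t + n) = (f ^^ n) (y t)" for t n
    by (induction n) (auto simp: y)
  define A where "A = {j. (j, i) \<in> E \<and> (i, j) \<notin> E}"
  have "eventually_geometric (\<lambda>k. y k j)" if j: "j \<in> A" for j
  proof (rule less)
    show "card {k. (k, j) \<in> E \<or> k = j} < card {k. (k, i) \<in> E \<or> k = i}"
    proof (rule psubset_card_mono)
      have "i \<noteq> j" "(i, j) \<notin> E" using j by (auto simp: A_def)
      then show "{k. (k, j) \<in> E \<or> k = j} \<subset> {k. (k, i) \<in> E \<or> k = i}"
        using j E_trans by (auto simp: A_def)
    qed simp
  qed
  then obtain k0 q where q: "q > 0" "\<And>j t. j \<in> A \<Longrightarrow> t \<ge> k0 \<Longrightarrow> geometric (\<lambda>k. y (t + q * k) j)"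
    using eventually_geometric_common[OF finite, of A "\<lambda>j k. y k j"] by blast
  \<comment> \<open>Idempotence leaves \<open>E\<close> unchanged when \<open>q\<close> steps are
    taken as one, so the clique lemmas apply to \<open>f ^^ q\<close> with the same
    relation.\<close>
  have relpow: "E ^^ n = E" if "n > 0" for n
    using that by (induction n rule: nat_induct_non_zero) (auto simp: idem)
  interpret F: rounded_map p E "f ^^ q"
    using rounded_map_funpow[OF rounded_map_axioms q(1)] relpow[OF q(1)] by simp
  have zstep: "y (t + q * Suc k) = (f ^^ q) (y (t + q * k))" for t k
    using iter[of "t + q * k" q] by (simp add: add_ac)
  have "eventually_geometric (\<lambda>k. y (t + q * k) i)" if t: "t \<ge> k0" for t
  proof (cases "(i, i) \<in> E")
    case False
    \<comment> \<open>A \<open>j\<close> that feeds \<open>i\<close> and is fed by it would give a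
      self-loop at \<open>i\<close> by transitivity.\<close>
    have A: "(j, i) \<in> E \<Longrightarrow> j \<in> A" for j using False E_trans by (auto simp: A_def)
    obtain g :: "'n \<Rightarrow> int" where g: "\<And>j k. j \<in> A \<Longrightarrow>
        y (t + q * k) j = 10 powi (g j * int k) * y (t + q * 0) j"
      using q(2)[OF _ t] unfolding geometric_def by metis
    show ?thesis
    proof (rule F.geometric_inputs)
      show "y (t + q * Suc k) i = (f ^^ q) (y (t + q * k)) i" for k by (simp only: zstep)
    qed (use nn A g in auto)
  next
    case True
    define D where "D = {j. (j, i) \<in> E \<and> (i, j) \<in> E}"
    have i: "i \<in> D" using True by (simp add: D_def)
    \<comment> \<open>By transitivity through \<open>i\<close>, all members of \<open>D\<close> have
      the same predecessors as \<open>i\<close>.\<close>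
    have preds: "(j, l) \<in> E \<longleftrightarrow> j \<in> D \<or> j \<in> A" if "l \<in> D" for j l
      using that E_trans by (auto simp: D_def A_def)
    have disj: "D \<inter> A = {}" by (auto simp: D_def A_def)
    obtain c where c: "c > 0"
      "\<And>v i j. (\<forall>k. 0 \<le> v k) \<Longrightarrow> (j, i) \<in> E \<Longrightarrow> c * v j \<le> (f ^^ q) v i"
      using F.uniform_lower by blast
    show ?thesis
    \<comment> \<open>Either \<open>i\<close> is 0 along the whole subsequence, or once positive it
      stays so and makes all of \<open>D\<close> positive one step later.\<close>
    proof (cases "\<forall>k. y (t + q * k) i = 0")
      case True
      show ?thesis
        by (rule eventually_geometric_recurrence[of 1 0 _ 0]) (use True in \<open>simp_all del: mult_Suc_right\<close>)
    next
      case False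
      then obtain k1 where k1: "0 < y (t + q * k1) i"
        using nn by (metis order_le_less)
      have pos_step: "0 < y (t + q * Suc k) j" if "0 < y (t + q * k) i" "j \<in> D" for k j
      proof -
        have "0 < c * y (t + q * k) i" using c that by simp
        also have "\<dots> \<le> (f ^^ q) (y (t + q * k)) j"
          using that nn by (intro c(2)) (auto simp: D_def)
        finally show ?thesis by (simp only: zstep)
      qed
      have pos_i: "0 < y (t + q * (k1 + k)) i" for k
        by (induction k) (use k1 pos_step[OF _ i] in auto)
      have pos: "0 < y (t + q * Suc (k1 + k)) j" if "j \<in> D" for k j
        using pos_step[OF pos_i that] .
      \<comment> \<open>One step beyond \<open>k1\<close>, when all of \<open>D\<close> is positive;
        as images under \<open>f ^^ q\<close> the values are floating-point numbers, too.\<close>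
      define t' where "t' = t + q * Suc k1"
      have t': "t + q * (Suc k1 + k) = t' + q * k" for k by (simp add: t'_def algebra_simps)
      have t'_ge: "t' \<ge> k0" using t by (simp add: t'_def)
      obtain g :: "'n \<Rightarrow> int" where g: "\<And>j k. j \<in> A \<Longrightarrow>
          y (t' + q * k) j = 10 powi (g j * int k) * y (t' + q * 0) j"
        using q(2)[OF _ t'_ge] unfolding geometric_def by metis
      have "eventually_geometric (\<lambda>k. y (t' + q * k) i)"
      proof (rule F.clique_geometric_inputs[OF i preds disj _ _ _ _ i])
        show "y (t' + q * Suc k) l = (f ^^ q) (y (t' + q * k)) l" for k l by (simp only: zstep)
        show "y (t' + q * k) j \<in> float_numbers p \<and> 0 < y (t' + q * k) j" if "j \<in> D" for k j
        proof
          have "y (t' + q * k) = (f ^^ q) (y (t + q * (k1 + k)))"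
            using zstep[of t "k1 + k"] t'[of k] by simp
          then show "y (t' + q * k) j \<in> float_numbers p" using F.float by simp
          show "0 < y (t' + q * k) j" using pos[OF that, of k] t'[of k] by simp
        qed
      qed (use nn g in auto)
      then show ?thesis
        unfolding t' [symmetric]
        by (rule eventually_geometric_shift[where u = "\<lambda>k. y (t + q * k) i"])
    qed
  qed
  then have "eventually_geometric (\<lambda>k. y (k0 + (s + q * k)) i)" for s
    by (simp add: add.assoc [symmetric])
  then show ?case
    by (intro eventually_geometric_shift[where u = "\<lambda>k. y k i" and ?k0.0 = k0]
        eventually_geometric_residues[OF q(1), where u = "\<lambda>k. y (k0 + k) i"])
qed

end

text \<open>Iterating \<open>q\<close> times makes the dependency relation idempotent; on each
  residue class modulo \<open>q\<close> the orbit is then an orbit of the iterated map.\<close>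

lemma rounded_orbit_eventually_geometric:
  fixes M :: "real ^ 'n ^ 'n" and x :: "real ^ 'n"
  assumes "p \<ge> 1" and "float_rounding p r"
    and "\<And>i j. 0 \<le> M $ i $ j" and "\<And>i. 0 \<le> x $ i"
  shows "eventually_geometric (\<lambda>t. rounded_orbit r M x t $ i)"
proof -
  define E where "E = {(j, i). 0 < M $ i $ j}"
  define f where "f = (\<lambda>v i. r (\<Sum>j\<in>UNIV. M $ i $ j * v j))"
  define y where "y t = (\<lambda>j. rounded_orbit r M x t $ j)" for t
  interpret f: rounded_map p E f
    unfolding E_def f_def using assms by (intro rounded_map_matrix)
  have y: "y (Suc t) = f (y t)" for t
    by (auto simp: y_def f_def round_vec_def matrix_vector_mult_def)
  have "0 \<le> r (x $ j)" for j
    using float_rounding_nonneg_bounds(1)[OF assms(2,1), of "x $ j"] assms(4)[of j] by simp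
  then have nn: "0 \<le> y t j" for t j
    by (induction t arbitrary: j) (auto simp: y intro: f.nonneg, auto simp: y_def round_vec_def)
  have iter: "y (t + n) = (f ^^ n) (y t)" for t n
    by (induction n) (auto simp: y)
  obtain q where q: "q > 0" "(E ^^ q) O (E ^^ q) = E ^^ q"
    using idempotent_relpow by blast
  interpret F: rounded_map p "E ^^ q" "f ^^ q"
    using rounded_map_funpow[OF f.rounded_map_axioms q(1)] .
  have "eventually_geometric (\<lambda>k. y (s + q * k) i)" for s
  proof (rule F.orbit_eventually_geometric[OF q(2)])
    show "y (s + q * Suc k) = (f ^^ q) (y (s + q * k))" for k
      using iter[of "s + q * k" q] by (simp add: add_ac)
  qed (rule nn)
  then have "eventually_geometric (\<lambda>t. y t i)"
    by (intro eventually_geometric_residues[OF q(1), where u = "\<lambda>t. y t i"])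
  then show ?thesis by (simp add: y_def)
qed

section \<open>Semialgebraic targets\<close>

text \<open>Laurent polynomials in \<open>10 ^ k\<close>, encoded by clearing denominators with a
  power of \<open>10 ^ k\<close>.\<close>

definition decimal_polynomial :: "(nat \<Rightarrow> real) \<Rightarrow> bool" where
  "decimal_polynomial h \<longleftrightarrow> (\<exists>P N. \<forall>k. 10 ^ (N * k) * h k = poly P (10 ^ k))"

lemma decimal_polynomial_const: "decimal_polynomial (\<lambda>k. c)"
  unfolding decimal_polynomial_def by (intro exI[of _ "[:c:]"] exI[of _ 0]) simp

lemma decimal_polynomial_add:
  assumes "decimal_polynomial h" "decimal_polynomial h'"
  shows "decimal_polynomial (\<lambda>k. h k + h' k)"
proof -
  obtain P N P' N' where "\<And>k. 10 ^ (N * k) * h k = poly P (10 ^ k)"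
    "\<And>k. 10 ^ (N' * k) * h' k = poly P' (10 ^ k)"
    using assms unfolding decimal_polynomial_def by blast
  note eq = this[symmetric]
  have "10 ^ ((N + N') * k) * (h k + h' k) = poly (monom 1 N' * P + monom 1 N * P') (10 ^ k)" for k
    by (simp add: poly_monom eq power_mult [symmetric] power_add algebra_simps)
  then show ?thesis unfolding decimal_polynomial_def by blast
qed

lemma decimal_polynomial_mult:
  assumes "decimal_polynomial h" "decimal_polynomial h'"
  shows "decimal_polynomial (\<lambda>k. h k * h' k)"
proof -
  obtain P N P' N' where "\<And>k. 10 ^ (N * k) * h k = poly P (10 ^ k)"
    "\<And>k. 10 ^ (N' * k) * h' k = poly P' (10 ^ k)"
    using assms unfolding decimal_polynomial_def by blast
  note eq = this[symmetric]
  have "10 ^ ((N + N') * k) * (h k * h' k) = poly (P * P') (10 ^ k)" for k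
    by (simp add: eq power_add algebra_simps)
  then show ?thesis unfolding decimal_polynomial_def by blast
qed

lemma decimal_polynomial_sum:
  assumes "finite I" "\<And>i. i \<in> I \<Longrightarrow> decimal_polynomial (h i)"
  shows "decimal_polynomial (\<lambda>k. \<Sum>i\<in>I. h i k)"
  using assms
  by (induction I) (auto intro: decimal_polynomial_const decimal_polynomial_add)

lemma decimal_polynomial_geometric:
  assumes "geometric u"
  shows "decimal_polynomial u"
proof -
  obtain g :: int where g: "\<And>k. u k = 10 powi (g * int k) * u 0"
    using assms unfolding geometric_def by blast
  define N where "N = nat \<bar>g\<bar>"
  have "10 ^ (N * k) * u k = poly (monom (u 0) (nat (g + \<bar>g\<bar>))) (10 ^ k)" for k
  proof -
    have "(10::real) ^ (N * k) * 10 powi (g * int k) = 10 powi (int (N * k) + g * int k)"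
      by (subst power_int_add) (simp_all only: power_int_of_nat, simp)
    also have "int (N * k) + g * int k = int (k * nat (g + \<bar>g\<bar>))"
      by (auto simp: N_def algebra_simps)
    also have "(10::real) powi \<dots> = (10 ^ k) ^ nat (g + \<bar>g\<bar>)"
      by (simp only: power_int_of_nat power_mult)
    finally show ?thesis
      unfolding poly_monom g[of k] mult.assoc [symmetric] by (simp only: mult.commute)
  qed
  then show ?thesis unfolding decimal_polynomial_def by blast
qed

text \<open>Clearing the positive denominator leaves the sign of \<open>poly P (10 ^ k)\<close>,
  which for large \<open>k\<close> is that of the leading coefficient; \<open>P = 0\<close> falls
  under the first alternative.\<close>

lemma decimal_polynomial_eventually_sign:
  assumes "decimal_polynomial h"
  shows "(\<forall>\<^sub>F k in sequentially. 0 \<le> h k) \<or> (\<forall>\<^sub>F k in sequentially. \<not> 0 \<le> h k)"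
proof -
  obtain P N where P: "\<And>k. 10 ^ (N * k) * h k = poly P (10 ^ k)"
    using assms unfolding decimal_polynomial_def by blast
  have h: "0 \<le> h k \<longleftrightarrow> 0 \<le> poly P (10 ^ k)" for k
  proof -
    have "(10::real) ^ (N * k) > 0" by simp
    then show ?thesis unfolding P[of k, symmetric] by (simp only: zero_le_mult_iff) linarith
  qed
  have pos: "\<forall>\<^sub>F k in sequentially. 0 < poly Q (10 ^ k)" if Q: "lead_coeff Q > 0" for Q :: "real poly"
  proof -
    obtain n where n: "\<forall>x\<ge>n. lead_coeff Q \<le> poly Q x" using poly_pinfty_gt_lc[OF Q] by blast
    obtain k0 where k0: "n < 10 ^ k0" using real_arch_pow[of 10 n] by auto
    have "\<forall>\<^sub>F k in sequentially. k0 \<le> k" by (rule eventually_ge_at_top)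
    then have "\<forall>\<^sub>F k in sequentially. n \<le> (10::real) ^ k"
    proof eventually_elim
      case (elim k)
      have "(10::real) ^ k0 \<le> 10 ^ k" using elim by (intro power_increasing) auto
      then show ?case using k0 by linarith
    qed
    then show ?thesis
      by eventually_elim (use n Q in \<open>auto intro: less_le_trans\<close>)
  qed
  consider "P = 0" | "lead_coeff P > 0" | "lead_coeff (- P) > 0"
    by (cases "lead_coeff P" "0::real" rule: linorder_cases) auto
  then show ?thesis
  proof cases
    case 2
    then have "\<forall>\<^sub>F k in sequentially. 0 \<le> h k"
      using pos[OF 2] unfolding h by (auto elim: eventually_mono)
    then show ?thesis by blast
  next
    case 3
    have "\<forall>\<^sub>F k in sequentially. \<not> 0 \<le> h k"
      using pos[OF 3] unfolding h by (auto elim: eventually_mono)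
    then show ?thesis by blast
  qed (simp add: h)
qed

text \<open>Linear building blocks of \<open>f\<close> expand into coordinates, which are geometric;
  sums and products stay in the class.\<close>

lemma decimal_polynomial_polynomial_function:
  fixes u :: "nat \<Rightarrow> real ^ 'n"
  assumes "real_polynomial_function f" and "\<And>i. geometric (\<lambda>k. u k $ i)"
  shows "decimal_polynomial (\<lambda>k. f (u k))"
  using assms(1)
proof induction
  case (linear f)
  interpret bounded_linear f by fact
  have "f (u k) = (\<Sum>i\<in>UNIV. u k $ i * f (axis i 1))" for k
  proof -
    have "f (u k) = f (\<Sum>i\<in>UNIV. (u k $ i) *\<^sub>R axis i 1)"
      by (simp add: basis_expansion scalar_mult_eq_scaleR [symmetric])
    then show ?thesis by (simp add: sum scaleR)
  qed
  then show ?case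
    by (simp, intro decimal_polynomial_sum decimal_polynomial_mult decimal_polynomial_const
        decimal_polynomial_geometric assms(2)) simp
qed (auto intro: decimal_polynomial_const decimal_polynomial_add decimal_polynomial_mult)

text \<open>Polynomial inequalities are settled by eventual signs, and Boolean operations preserve
  eventual constancy of membership.\<close>

lemma semialgebraic_eventually_constant:
  fixes u :: "nat \<Rightarrow> real ^ 'n"
  assumes "semialgebraic Y" and "\<And>i. geometric (\<lambda>k. u k $ i)"
  shows "(\<forall>\<^sub>F k in sequentially. u k \<in> Y) \<or> (\<forall>\<^sub>F k in sequentially. u k \<notin> Y)"
  using assms(1)
proof induction
  case (ineq f)
  show ?case
    using decimal_polynomial_eventually_sign[OF
        decimal_polynomial_polynomial_function[OF ineq assms(2)]] by simp
next
  case (inter A B)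
  have "\<forall>\<^sub>F k in sequentially. u k \<notin> A \<inter> B"
    if "(\<forall>\<^sub>F k in sequentially. u k \<notin> A) \<or> (\<forall>\<^sub>F k in sequentially. u k \<notin> B)"
    using that by (elim disjE eventually_mono) auto
  then show ?case using inter.IH by (auto simp: eventually_conj_iff)
next
  case (union A B)
  have "\<forall>\<^sub>F k in sequentially. u k \<in> A \<union> B"
    if "(\<forall>\<^sub>F k in sequentially. u k \<in> A) \<or> (\<forall>\<^sub>F k in sequentially. u k \<in> B)"
    using that by (elim disjE eventually_mono) auto
  then show ?case using union.IH by (auto simp: eventually_conj_iff)
qed auto

text \<open>The elements below \<open>t0\<close> form the finite part, and those in the window of
  length \<open>q\<close> starting at \<open>t0\<close> are the offsets of the arithmetic
  progressions.\<close>

lemma semi_linear_eventually_periodic: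
  assumes "q > 0" and per: "\<And>t. t \<ge> t0 \<Longrightarrow> t + q \<in> X \<longleftrightarrow> t \<in> X"
  shows "semi_linear X"
proof -
  define B where "B = {t \<in> X. t0 \<le> t \<and> t < t0 + q}"
  have "finite B" by (rule finite_subset[of _ "{..<t0 + q}"]) (auto simp: B_def)
  then obtain b where b: "bij_betw b {1..card B} B"
    using ex_bij_betw_nat_finite_1 by blast
  have iter: "t + k * q \<in> X \<longleftrightarrow> t \<in> X" if "t \<ge> t0" for t k
  proof (induction k)
    case (Suc k)
    then show ?case using per[of "t + k * q"] that by (simp add: add_ac)
  qed simp
  have "t \<in> X \<longleftrightarrow> t \<in> {t \<in> X. t < t0} \<or> (\<exists>k. \<exists>i\<in>{1..card B}. t = b i + k * q)" for t
  proof -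
    have "t \<in> X \<longleftrightarrow> (\<exists>k. \<exists>s\<in>B. t = s + k * q)" if t: "t \<ge> t0"
    proof
      assume "t \<in> X"
      define s where "s = t0 + (t - t0) mod q"
      have eq: "t = s + (t - t0) div q * q"
        using t by (simp add: s_def)
      have "s \<in> X" using iter[of s "(t - t0) div q"] \<open>t \<in> X\<close> eq by (simp add: s_def)
      then have "s \<in> B" using assms(1) by (simp add: B_def s_def)
      then show "\<exists>k. \<exists>s\<in>B. t = s + k * q" using eq by blast
    qed (auto simp: B_def iter)
    moreover have "s + k * q \<ge> t0" if "s \<in> B" for s k using that by (simp add: B_def)
    moreover have "(\<exists>i\<in>{1..card B}. t = b i + k * q) \<longleftrightarrow> (\<exists>s\<in>B. t = s + k * q)" for k
      using bij_betw_imp_surj_on[OF b] by (metis image_iff)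
    ultimately show ?thesis unfolding mem_Collect_eq by (metis not_less)
  qed
  moreover have "finite {t \<in> X. t < t0}" by simp
  ultimately show ?thesis unfolding semi_linear_def by blast
qed

theorem theorem5:
  fixes M :: "real ^ 'n ^ 'n" and x :: "real ^ 'n"
    and p :: nat and r :: "real \<Rightarrow> real" and Y :: "(real ^ 'n) set"
  assumes "p \<ge> 1"
    and "float_rounding p r"
    and "\<And>i j. M $ i $ j \<in> \<rat>" and "\<And>i. x $ i \<in> \<rat>"
    and "\<And>i j. 0 \<le> M $ i $ j" and "\<And>i. 0 \<le> x $ i"
    and "semialgebraic Y"
  shows "semi_linear (hitting_set (rounded_orbit r M x) Y)"
proof -
  let ?u = "rounded_orbit r M x"
  obtain k0 q where q: "q > 0" "\<And>i t. t \<ge> k0 \<Longrightarrow> geometric (\<lambda>k. ?u (t + q * k) $ i)"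
    using eventually_geometric_common[OF finite, of UNIV "\<lambda>i t. ?u t $ i"]
      rounded_orbit_eventually_geometric[OF assms(1,2,5,6)] by auto
  \<comment> \<open>Each residue class is eventually inside \<open>Y\<close> or eventually outside
    it, so a shift by \<open>q\<close> eventually preserves membership.\<close>
  have "\<forall>\<^sub>F k in sequentially. ?u (k0 + s + q * Suc k) \<in> Y \<longleftrightarrow> ?u (k0 + s + q * k) \<in> Y" for s
  proof -
    have "(\<forall>\<^sub>F k in sequentially. ?u (k0 + s + q * k) \<in> Y) \<or> (\<forall>\<^sub>F k in sequentially. ?u (k0 + s + q * k) \<notin> Y)"
      using q(2) by (intro semialgebraic_eventually_constant assms) simp
    then show ?thesis
    proof
      assume *: "\<forall>\<^sub>F k in sequentially. ?u (k0 + s + q * k) \<in> Y"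
      then have "\<forall>\<^sub>F k in sequentially. ?u (k0 + s + q * Suc k) \<in> Y"
        by (subst eventually_sequentially_Suc)
      with * show ?thesis by eventually_elim simp
    next
      assume *: "\<forall>\<^sub>F k in sequentially. ?u (k0 + s + q * k) \<notin> Y"
      then have "\<forall>\<^sub>F k in sequentially. ?u (k0 + s + q * Suc k) \<notin> Y"
        by (subst eventually_sequentially_Suc)
      with * show ?thesis by eventually_elim simp
    qed
  qed
  \<comment> \<open>There are only \<open>q\<close> residues, so they share one threshold
    \<open>N\<close>.\<close>
  then have "\<forall>\<^sub>F k in sequentially. \<forall>s\<in>{..<q}. ?u (k0 + s + q * Suc k) \<in> Y \<longleftrightarrow> ?u (k0 + s + q * k) \<in> Y"
    by (intro eventually_ball_finite) auto
  then obtain N where N: "\<And>k s. k \<ge> N \<Longrightarrow> s < q \<Longrightarrow>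
      ?u (k0 + s + q * Suc k) \<in> Y \<longleftrightarrow> ?u (k0 + s + q * k) \<in> Y"
    unfolding eventually_sequentially by blast
  show ?thesis
  proof (rule semi_linear_eventually_periodic[OF q(1)])
    fix t assume t: "t \<ge> k0 + q * N"
    define s k where "s = (t - k0) mod q" and "k = (t - k0) div q"
    have "t - k0 \<ge> N * q" using t by (simp add: mult.commute)
    then have "k \<ge> N" "s < q"
      using q(1) by (simp_all add: s_def k_def less_eq_div_iff_mult_less_eq)
    moreover have "t = k0 + s + q * k" using t by (simp add: s_def k_def)
    ultimately show "t + q \<in> hitting_set ?u Y \<longleftrightarrow> t \<in> hitting_set ?u Y"
      using N[of k s] by (simp add: hitting_set_def add_ac)
  qed
qed

end
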